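(* Let $\gamma:[0,L]\to\mathbb{R}^2$ be a smooth closed planar curve, parametrized by arc length, with positive curvature, having only finitely many self-intersection points, all of which are transverse. Then the normalized arc-length measure $\mu$ of $\gamma$, given by $\int f\,d\mu=\frac1L\int_0^L f(\gamma(t))\,dt$ for continuous $f$, is not a tight-frame spectral measure.
   Context: A smooth closed curve is an infinitely differentiable $\gamma:[0,L]\to\mathbb{R}^2$ with $\gamma^{(n)}(0)=\gamma^{(n)}(L)$ for all $n\ge 0$; the endpoints $0$ and $L$ are identified as parameters. Parametrized by arc length means $\|\gamma'\|\equiv 1$. With $\mathbf n$ the unit normal such that $\{\gamma',\mathbf n\}$ is positively oriented, the curvature is $\kappa(s)=\pm\|\gamma''(s)\|$, the sign depending on whether $\gamma''(s)$ has the same or opposite direction as $\mathbf n$; the curve is said to have positive curvature if its curvature never vanishes. A self-intersection point is a point $x_0$ with $x_0=\gamma(s)=\gamma(t)$ for some distinct parameters $s,t$ (with $0$ and $L$ identified). It is transverse if $x_0$ has only finitely many preimages under $\gamma$ and $\gamma'(s)$, $\gamma'(t)$ are not parallel for all distinct $s,t$ with $\gamma(s)=\gamma(t)=x_0$. A compactly supported Borel probability measure $\mu$ on $\mathbb{R}^d$ is a tight-frame spectral measure if there exist a countable set $\Lambda\subset\mathbb{R}^d$ and a constant $A>0$ such that $\sum_{\lambda\in\Lambda}\left|\int f(x)e^{-2\pi i\lambda\cdot x}\,d\mu(x)\right|^2=A\int |f|^2\,d\mu$ for all $f\in L^2(\mu)$. *)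

theory Defs
  imports "HOL-Probability.Probability"
begin

text \<open>
  A curve on \<open>[0, L]\<close> is a total function whose values outside \<open>{0..L}\<close> are never used;
  derivatives are taken within \<open>{0..L}\<close>, so they are one-sided at the two endpoints.
\<close>

primrec iter_deriv :: "real \<Rightarrow> nat \<Rightarrow> (real \<Rightarrow> 'a::real_normed_vector) \<Rightarrow> real \<Rightarrow> 'a" where
  "iter_deriv L 0 \<gamma> = \<gamma>"
| "iter_deriv L (Suc n) \<gamma> =
     (\<lambda>t. vector_derivative (iter_deriv L n \<gamma>) (at t within {0..L}))"

definition smooth_closed_curve :: "real \<Rightarrow> (real \<Rightarrow> 'a::real_normed_vector) \<Rightarrow> bool" where
  "smooth_closed_curve L \<gamma> \<longleftrightarrow>
     0 < L \<and>
     (\<forall>n. \<forall>t\<in>{0..L}. iter_deriv L n \<gamma> differentiable (at t within {0..L})) \<and>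
     (\<forall>n. iter_deriv L n \<gamma> 0 = iter_deriv L n \<gamma> L)"

definition arc_length_parametrized :: "real \<Rightarrow> (real \<Rightarrow> 'a::real_normed_vector) \<Rightarrow> bool" where
  "arc_length_parametrized L \<gamma> \<longleftrightarrow> (\<forall>t\<in>{0..L}. norm (iter_deriv L 1 \<gamma> t) = 1)"

definition rotate_quarter :: "real^2 \<Rightarrow> real^2" where
  "rotate_quarter v = vector [- (v $ 2), v $ 1]"

text \<open>
  For a unit vector \<open>v\<close>, \<open>rotate_quarter v\<close> is the only unit vector orthogonal to \<open>v\<close> for which
  the pair is positively oriented.
\<close>

lemma rotate_quarter_iff:
  fixes v w :: "real^2"
  assumes "norm v = 1"
  shows "w = rotate_quarter v \<longleftrightarrow>
    norm w = 1 \<and> v \<bullet> w = 0 \<and> det (vector [v, w] :: real^2^2) > 0"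
proof -
  obtain a b where ab: "v $ 1 = a" "v $ 2 = b" by blast
  obtain c d where cd: "w $ 1 = c" "w $ 2 = d" by blast
  have v1: "a * a + b * b = 1"
    using assms ab by (simp add: norm_eq_1 inner_vec_def sum_2)
  have "w = rotate_quarter v \<longleftrightarrow> c = - b \<and> d = a"
    by (simp add: vec_eq_iff forall_2 rotate_quarter_def ab cd)
  moreover have "norm w = 1 \<longleftrightarrow> c * c + d * d = 1"
    by (simp add: norm_eq_1 inner_vec_def sum_2 cd)
  moreover have "v \<bullet> w = a * c + b * d"
    by (simp add: inner_vec_def sum_2 ab cd)
  moreover have "det (vector [v, w] :: real^2^2) = a * d - b * c"
    by (simp add: det_2 ab cd)
  moreover have "c = - b \<and> d = a \<longleftrightarrow>
      c * c + d * d = 1 \<and> a * c + b * d = 0 \<and> a * d - b * c > 0" (is "?l \<longleftrightarrow> ?r")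
  proof
    assume ?l
    then show ?r using v1 by (simp add: algebra_simps)
  next
    assume r: ?r
    define k where "k = a * d - b * c"
    have "k * a = d * (a * a + b * b) - b * (a * c + b * d)"
      by (simp add: k_def algebra_simps)
    then have d: "d = k * a" using v1 r by simp
    have "k * b = a * (a * c + b * d) - c * (a * a + b * b)"
      by (simp add: k_def algebra_simps)
    then have c: "c = - (k * b)" using v1 r by simp
    have "k * k * (a * a + b * b) = 1" using r by (simp add: c d algebra_simps)
    then have "k\<^sup>2 = 1" using v1 by (simp add: power2_eq_square)
    then have "k = 1" using r by (simp add: k_def power2_eq_1_iff)
    then show ?l using c d by simp
  qed
  ultimately show ?thesis by simp
qed

definition unit_normal :: "real \<Rightarrow> (real \<Rightarrow> real^2) \<Rightarrow> real \<Rightarrow> real^2" where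
  "unit_normal L \<gamma> s = rotate_quarter (iter_deriv L 1 \<gamma> s)"

text \<open>
  For an arc-length parametrization, \<open>\<gamma>''(s)\<close> is always a multiple of the unit normal, so the
  \<open>else\<close> branch is the case of the opposite direction.
\<close>

definition curvature :: "real \<Rightarrow> (real \<Rightarrow> real^2) \<Rightarrow> real \<Rightarrow> real" where
  "curvature L \<gamma> s =
     (if \<exists>c\<ge>0. iter_deriv L 2 \<gamma> s = c *\<^sub>R unit_normal L \<gamma> s
      then norm (iter_deriv L 2 \<gamma> s) else - norm (iter_deriv L 2 \<gamma> s))"

definition positive_curvature :: "real \<Rightarrow> (real \<Rightarrow> real^2) \<Rightarrow> bool" where
  "positive_curvature L \<gamma> \<longleftrightarrow> (\<forall>s\<in>{0..L}. curvature L \<gamma> s \<noteq> 0)"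

text \<open>The parameters \<open>0\<close> and \<open>L\<close> are identified by letting parameters range over \<open>{0..<L}\<close>.\<close>

definition self_intersection_points :: "real \<Rightarrow> (real \<Rightarrow> 'a) \<Rightarrow> 'a set" where
  "self_intersection_points L \<gamma> =
     {x. \<exists>s\<in>{0..<L}. \<exists>t\<in>{0..<L}. s \<noteq> t \<and> \<gamma> s = x \<and> \<gamma> t = x}"

definition transverse_at :: "real \<Rightarrow> (real \<Rightarrow> 'a::real_normed_vector) \<Rightarrow> 'a \<Rightarrow> bool" where
  "transverse_at L \<gamma> x \<longleftrightarrow>
     finite {s\<in>{0..<L}. \<gamma> s = x} \<and>
     (\<forall>s\<in>{0..<L}. \<forall>t\<in>{0..<L}. s \<noteq> t \<and> \<gamma> s = x \<and> \<gamma> t = x \<longrightarrow>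
        \<not> collinear {0, iter_deriv L 1 \<gamma> s, iter_deriv L 1 \<gamma> t})"

definition arc_length_measure ::
    "real \<Rightarrow> (real \<Rightarrow> 'a::euclidean_space) \<Rightarrow> 'a measure" where
  "arc_length_measure L \<gamma> =
     scale_measure (ennreal (1 / L)) (distr (restrict_space lborel {0..L}) borel \<gamma>)"

text \<open>
  The predicate is meant for compactly supported Borel probability measures. These conditions are
  not conjuncts of it, so that its negation is a statement about frames only; arc-length measures
  satisfy them by the lemmas below.
\<close>

definition tight_frame_spectral :: "'a::euclidean_space measure \<Rightarrow> bool" where
  "tight_frame_spectral \<mu> \<longleftrightarrow>
     (\<exists>\<Lambda> :: 'a set. \<exists>A :: real. countable \<Lambda> \<and> 0 < A \<and>
       (\<forall>f :: 'a \<Rightarrow> complex.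
          f \<in> borel_measurable \<mu> \<and> integrable \<mu> (\<lambda>x. (cmod (f x))\<^sup>2) \<longrightarrow>
          ((\<lambda>l. (cmod (\<integral>x. f x * exp (- 2 * of_real pi * \<i> * of_real (l \<bullet> x)) \<partial>\<mu>))\<^sup>2)
             has_sum (A * (\<integral>x. (cmod (f x))\<^sup>2 \<partial>\<mu>))) \<Lambda>))"

lemma smooth_closed_curve_continuous_on:
  assumes "smooth_closed_curve L \<gamma>"
  shows "continuous_on {0..L} \<gamma>"
proof -
  have "\<forall>t\<in>{0..L}. iter_deriv L 0 \<gamma> differentiable (at t within {0..L})"
    using assms unfolding smooth_closed_curve_def by blast
  then show ?thesis
    by (auto simp: continuous_on_eq_continuous_within intro: differentiable_imp_continuous_within)
qed

lemma sets_arc_length_measure [simp]: "sets (arc_length_measure L \<gamma>) = sets borel"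
  by (simp add: arc_length_measure_def)

lemma measurable_restrict_lborel:
  fixes \<gamma> :: "real \<Rightarrow> 'a::euclidean_space"
  assumes "continuous_on {0..L} \<gamma>"
  shows "\<gamma> \<in> borel_measurable (restrict_space lborel {0..L})"
proof -
  have "\<gamma> \<in> borel_measurable (restrict_space borel {0..L})"
    by (rule borel_measurable_continuous_on_restrict[OF assms])
  then show ?thesis
    by (simp cong: measurable_cong_sets add: sets_restrict_space_cong[of lborel borel])
qed

lemma emeasure_arc_length_measure:
  fixes \<gamma> :: "real \<Rightarrow> 'a::euclidean_space"
  assumes "smooth_closed_curve L \<gamma>" and "B \<in> sets borel"
  shows "emeasure (arc_length_measure L \<gamma>) B = ennreal (1 / L) * emeasure lborel (\<gamma> -` B \<inter> {0..L})"
  using measurable_restrict_lborel[OF smooth_closed_curve_continuous_on[OF assms(1)]] assms(2)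
  by (simp add: arc_length_measure_def emeasure_distr space_restrict_space emeasure_restrict_space)

lemma emeasure_arc_length_measure_image:
  fixes \<gamma> :: "real \<Rightarrow> 'a::euclidean_space"
  assumes "smooth_closed_curve L \<gamma>" and "B \<in> sets borel" and "\<gamma> ` {0..L} \<subseteq> B"
  shows "emeasure (arc_length_measure L \<gamma>) B = 1"
proof -
  have L: "0 < L" using assms(1) by (simp add: smooth_closed_curve_def)
  have "\<gamma> -` B \<inter> {0..L} = {0..L}" using assms(3) by auto
  then show ?thesis
    using L by (simp add: emeasure_arc_length_measure[OF assms(1,2)] ennreal_mult[symmetric])
qed

lemma prob_space_arc_length_measure:
  fixes \<gamma> :: "real \<Rightarrow> 'a::euclidean_space"
  assumes "smooth_closed_curve L \<gamma>"
  shows "prob_space (arc_length_measure L \<gamma>)"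
  using emeasure_arc_length_measure_image[OF assms, of UNIV]
  by (auto intro!: prob_spaceI simp: sets_eq_imp_space_eq[OF sets_arc_length_measure])

lemma compact_support_arc_length_measure:
  fixes \<gamma> :: "real \<Rightarrow> 'a::euclidean_space"
  assumes "smooth_closed_curve L \<gamma>"
  shows "compact (\<gamma> ` {0..L})" and "emeasure (arc_length_measure L \<gamma>) (\<gamma> ` {0..L}) = 1"
proof -
  show c: "compact (\<gamma> ` {0..L})"
    using smooth_closed_curve_continuous_on[OF assms] by (rule compact_continuous_image) simp
  show "emeasure (arc_length_measure L \<gamma>) (\<gamma> ` {0..L}) = 1"
    using c assms by (intro emeasure_arc_length_measure_image) (auto intro: borel_compact)
qed

lemma integral_arc_length_measure:
  fixes \<gamma> :: "real \<Rightarrow> 'a::euclidean_space" and f :: "'a \<Rightarrow> complex"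
  assumes "smooth_closed_curve L \<gamma>" and "continuous_on UNIV f"
  shows "(\<integral>x. f x \<partial>arc_length_measure L \<gamma>) = (1 / L) *\<^sub>R (LINT t:{0..L}|lborel. f (\<gamma> t))"
proof -
  have L: "0 < L" using assms(1) by (simp add: smooth_closed_curve_def)
  have m: "\<gamma> \<in> borel_measurable (restrict_space lborel {0..L})"
    by (rule measurable_restrict_lborel[OF smooth_closed_curve_continuous_on[OF assms(1)]])
  have f: "f \<in> borel_measurable borel"
    using assms(2) by (rule borel_measurable_continuous_onI)
  let ?D = "distr (restrict_space lborel {0..L}) borel \<gamma>"
  have "arc_length_measure L \<gamma> = density ?D (\<lambda>_. ennreal (1 / L))"
    unfolding arc_length_measure_def
    by (rule measure_eqI) (auto simp: emeasure_density_const)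
  then have "(\<integral>x. f x \<partial>arc_length_measure L \<gamma>) = (\<integral>x. (1 / L) *\<^sub>R f x \<partial>?D)"
    using L f by (simp add: integral_density)
  also have "\<dots> = (1 / L) *\<^sub>R (\<integral>t. f (\<gamma> t) \<partial>restrict_space lborel {0..L})"
    using m f by (simp add: integral_distr)
  also have "(\<integral>t. f (\<gamma> t) \<partial>restrict_space lborel {0..L}) = (LINT t:{0..L}|lborel. f (\<gamma> t))"
    by (simp add: integral_restrict_space set_lebesgue_integral_def)
  finally show ?thesis .
qed

end

theory Submission
  imports Defs
begin

text \<open>
  Let \<open>E\<^sub>a\<^sub>b(x)\<close> be the Fourier transform at \<open>x\<close> of arc length on the arc \<open>\<gamma>[a, b]\<close>, and let
  \<open>w(x) = 1 / max 1 |x|\<close>. Curvature makes \<open>|E\<^sub>a\<^sub>b(x)|\<^sup>2\<close> decay exactly like \<open>w(x)\<close> in the directions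
  normal to the arc, and no slower in any other direction. In the plane this rate is borderline: the
  frequencies \<open>\<Lambda>\<close> of a frame would have to be sparse enough for \<open>w\<close> to be summable, and then they
  are too sparse for a lower frame bound.

  Testing the tight frame identity on the character \<open>exp(2 \<pi> i \<xi> \<bullet> x)\<close> cut off to an arc gives
  \<open>\<Sum>\<^sub>\<lambda> |E\<^sub>a\<^sub>b(\<lambda> - \<xi>)|\<^sup>2 = A (b - a)\<close> for some \<open>A > 0\<close>, all arcs and all \<open>\<xi>\<close>
  (\<open>tight_frame_arc_transform\<close>). Since the self-intersections have finitely many parameters, the
  rest of the curve meets the arc in a null set only.

  Summability of \<open>w\<close>. For a unit vector \<open>e\<close>, Rolle's theorem for \<open>e \<bullet> \<gamma>\<close> on the closed curve
  yields a point where \<open>e\<close> is normal to the curve, and positive curvature makes it a nondegenerate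
  stationary point of the phase. So a short arc around it has \<open>|E\<^sub>a\<^sub>b(x)|\<^sup>2 \<ge> c w(x)\<close> for all large \<open>x\<close>
  with direction close to \<open>e\<close> (\<open>arc_transform_ge_near_direction\<close>, from the stationary phase bound
  \<open>integral_cis_stationary_ge\<close>). Finitely many such cones and a ball, on which a very short arc has
  \<open>E\<^sub>a\<^sub>b\<close> close to \<open>b - a\<close>, cover the plane. With \<open>\<xi> = 0\<close> the frame identity then shows
  \<open>\<Sum>\<^sub>\<lambda> w(\<lambda>) < \<infinity>\<close> (\<open>decay_weight_summable\<close>).

  Contradiction. On one short arc van der Corput's lemma gives \<open>|E\<^sub>a\<^sub>b(x)|\<^sup>2 \<le> C w(x)\<close> everywhere
  (\<open>arc_transform_upper\<close>), so \<open>\<Sum>\<^sub>\<lambda> w(\<lambda> - \<xi>) \<ge> A (b - a) / C > 0\<close> for every \<open>\<xi>\<close>. But the average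
  of \<open>w(\<lambda> - \<xi>)\<close> over the \<open>n\<^sup>2\<close> grid points \<open>\<xi>\<close> of a square of side \<open>n\<close> is at most a constant times
  \<open>min (1 / n) (w(\<lambda>))\<close>. By dominated convergence the averages of the sums tend to \<open>0\<close>
  (\<open>translated_decay_weight_sums_not_bounded_below\<close>).
\<close>

section \<open>Oscillatory integrals\<close>

text \<open>
  One integration by parts against \<open>1 / \<phi>'\<close>. The function \<open>g\<close> majorizes the variation of \<open>1 / \<phi>'\<close>:
  for convex \<open>\<phi>\<close> it will be \<open>- 1 / \<phi>'\<close>, which gives a bound that does not depend on the size of \<open>\<phi>''\<close>,
  and where \<open>\<phi>''\<close> is just bounded it will be linear.
\<close>

lemma integral_cis_deriv_bound:
  fixes \<phi> \<phi>' \<phi>'' g g' :: "real \<Rightarrow> real"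
  assumes ab: "a \<le> b"
    and d1: "\<And>t. t \<in> {a..b} \<Longrightarrow> (\<phi> has_real_derivative \<phi>' t) (at t)"
    and d2: "\<And>t. t \<in> {a..b} \<Longrightarrow> (\<phi>' has_real_derivative \<phi>'' t) (at t)"
    and nz: "\<And>t. t \<in> {a..b} \<Longrightarrow> \<phi>' t \<noteq> 0"
    and dg: "\<And>t. t \<in> {a..b} \<Longrightarrow> (g has_real_derivative g' t) (at t)"
    and le: "\<And>t. t \<in> {a..b} \<Longrightarrow> \<bar>\<phi>'' t\<bar> / (\<phi>' t)\<^sup>2 \<le> g' t"
  shows "cmod (integral {a..b} (\<lambda>t. cis (\<phi> t))) \<le> 1 / \<bar>\<phi>' a\<bar> + 1 / \<bar>\<phi>' b\<bar> + (g b - g a)"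
proof -
  \<comment> \<open>The boundary term of the integration by parts.\<close>
  define B where "B t = - \<i> * cis (\<phi> t) / of_real (\<phi>' t)" for t
  define H where "H t = integral {a..t} (\<lambda>s. cis (\<phi> s)) - B t" for t
  have cont: "continuous_on {a..b} (\<lambda>t. cis (\<phi> t))"
    by (intro continuous_on_cis DERIV_atLeastAtMost_imp_continuous_on) (use d1 in auto)
  have dB: "(B has_vector_derivative (cis (\<phi> t) + \<i> * cis (\<phi> t) * of_real (\<phi>'' t / (\<phi>' t)\<^sup>2)))
      (at t within {a..b})" if t: "t \<in> {a..b}" for t
  proof -
    have c: "((\<lambda>t. cis (\<phi> t)) has_vector_derivative (\<phi>' t *\<^sub>R (\<i> * cis (\<phi> t)))) (at t within {a..b})"
      using has_derivative_cis[of \<phi> "\<lambda>h. h *\<^sub>R \<phi>' t" t "{a..b}"]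
        DERIV_subset[OF d1[OF t], of "{a..b}"]
      unfolding has_vector_derivative_def has_field_derivative_def
      by (simp add: mult_commute_abs)
    have i: "((\<lambda>t. inverse (\<phi>' t)) has_vector_derivative (- (\<phi>'' t / (\<phi>' t)\<^sup>2))) (at t within {a..b})"
      using DERIV_inverse'[OF DERIV_subset[OF d2[OF t], of "{a..b}"]] nz[OF t]
      unfolding has_real_derivative_iff_has_vector_derivative
      by (simp add: power2_eq_square field_simps)
    have "((\<lambda>t. inverse (\<phi>' t) *\<^sub>R (- \<i> * cis (\<phi> t))) has_vector_derivative
       (inverse (\<phi>' t) *\<^sub>R (- \<i> * (\<phi>' t *\<^sub>R (\<i> * cis (\<phi> t)))) + (- (\<phi>'' t / (\<phi>' t)\<^sup>2)) *\<^sub>R (- \<i> * cis (\<phi> t))))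
        (at t within {a..b})"
      by (rule has_vector_derivative_scaleR[OF i[folded has_real_derivative_iff_has_vector_derivative]])
        (intro has_vector_derivative_mult_right c)
    moreover have "(\<lambda>t. inverse (\<phi>' t) *\<^sub>R (- \<i> * cis (\<phi> t))) = B"
      by (auto simp: B_def scaleR_conv_of_real divide_simps)
    moreover have "inverse (\<phi>' t) *\<^sub>R (- \<i> * (\<phi>' t *\<^sub>R (\<i> * cis (\<phi> t)))) + (- (\<phi>'' t / (\<phi>' t)\<^sup>2)) *\<^sub>R (- \<i> * cis (\<phi> t))
      = cis (\<phi> t) + \<i> * cis (\<phi> t) * of_real (\<phi>'' t / (\<phi>' t)\<^sup>2)"
      using nz[OF t] by (simp add: scaleR_conv_of_real field_simps)
    ultimately show ?thesis by simp
  qed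
  have dH: "(H has_vector_derivative (- (\<i> * cis (\<phi> t) * of_real (\<phi>'' t / (\<phi>' t)\<^sup>2)))) (at t within {a..b})"
    if t: "t \<in> {a..b}" for t
  proof -
    have "(H has_vector_derivative (cis (\<phi> t) - (cis (\<phi> t) + \<i> * cis (\<phi> t) * of_real (\<phi>'' t / (\<phi>' t)\<^sup>2)))) (at t within {a..b})"
      unfolding H_def
      by (intro has_vector_derivative_diff integral_has_vector_derivative cont dB t)
    then show ?thesis by simp
  qed
  have "norm (H b - H a) \<le> g b - g a"
  proof (cases "a < b")
    case True
    show ?thesis
    proof (rule differentiable_bound_general[OF True])
      show "continuous_on {a..b} H"
        unfolding continuous_on_eq_continuous_within
        using dH has_vector_derivative_continuous by blast
      show "continuous_on {a..b} g"
        using dg by (intro continuous_at_imp_continuous_on ballI) (auto intro: DERIV_isCont)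
      fix t assume t: "a < t" "t < b"
      then have tt: "t \<in> {a..b}" by auto
      have op: "at t within {a..b} = at t" by (rule at_within_Icc_at) (use t in auto)
      show "(H has_vector_derivative (- (\<i> * cis (\<phi> t) * of_real (\<phi>'' t / (\<phi>' t)\<^sup>2)))) (at t)"
        using dH[OF tt] op by simp
      show "(g has_vector_derivative g' t) (at t)"
        using dg[OF tt] by (simp add: has_real_derivative_iff_has_vector_derivative)
      show "norm (- (\<i> * cis (\<phi> t) * of_real (\<phi>'' t / (\<phi>' t)\<^sup>2))) \<le> g' t"
        using le[OF tt] by (simp add: norm_mult norm_divide norm_power)
    qed
  next
    case False
    then have "a = b" using ab by simp
    then show ?thesis by simp
  qed
  moreover have "integral {a..b} (\<lambda>t. cis (\<phi> t)) = (H b - H a) + B b - B a"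
    by (simp add: H_def)
  moreover have "cmod (B t) = 1 / \<bar>\<phi>' t\<bar>" for t
    by (simp add: B_def norm_mult norm_divide)
  ultimately show ?thesis
    using norm_triangle_ineq4[of "(H b - H a) + B b" "B a"] norm_triangle_ineq[of "H b - H a" "B b"]
    by simp
qed

lemma deriv_ge_imp_growth:
  fixes f f' :: "real \<Rightarrow> real"
  assumes "x \<le> y"
    and "\<And>t. t \<in> {x..y} \<Longrightarrow> (f has_real_derivative f' t) (at t)"
    and "\<And>t. t \<in> {x..y} \<Longrightarrow> m \<le> f' t"
  shows "m * (y - x) \<le> f y - f x"
proof -
  have "f x - m * x \<le> f y - m * y"
    by (rule DERIV_nonneg_imp_nondecreasing[of x y "\<lambda>t. f t - m * t"])
      (use assms in \<open>auto intro!: exI derivative_eq_intros\<close>)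
  then show ?thesis by (simp add: algebra_simps)
qed

text \<open>
  Within \<open>1 / sqrt m\<close> of the point where \<open>\<phi>'\<close> may vanish the integrand is bounded by \<open>1\<close>. Beyond that,
  convexity gives \<open>\<phi>' \<ge> sqrt m\<close> and integration by parts applies.
\<close>

lemma van_der_Corput_half:
  fixes \<phi> \<phi>' \<phi>'' :: "real \<Rightarrow> real"
  assumes ab: "a \<le> b" and m: "0 < m"
    and d1: "\<And>t. t \<in> {a..b} \<Longrightarrow> (\<phi> has_real_derivative \<phi>' t) (at t)"
    and d2: "\<And>t. t \<in> {a..b} \<Longrightarrow> (\<phi>' has_real_derivative \<phi>'' t) (at t)"
    and conv: "\<And>t. t \<in> {a..b} \<Longrightarrow> m \<le> \<phi>'' t"
    and start: "0 \<le> \<phi>' a"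
  shows "cmod (integral {a..b} (\<lambda>t. cis (\<phi> t))) \<le> 3 / sqrt m"
proof -
  define \<delta> where "\<delta> = 1 / sqrt m"
  have \<delta>: "0 < \<delta>" using m by (simp add: \<delta>_def)
  have m\<delta>: "m * \<delta> = sqrt m" using m by (simp add: \<delta>_def real_div_sqrt)
  have cont: "continuous_on {a..b} (\<lambda>t. cis (\<phi> t))"
    by (intro continuous_on_cis DERIV_atLeastAtMost_imp_continuous_on) (use d1 in auto)
  have triv: "cmod (integral {a..c} (\<lambda>t. cis (\<phi> t))) \<le> c - a" if "a \<le> c" "c \<le> b" for c
    using integral_bound[of a c "\<lambda>t. cis (\<phi> t)" 1] that continuous_on_subset[OF cont, of "{a..c}"]
    by auto
  show ?thesis
  proof (cases "b \<le> a + \<delta>")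
    case True
    have "3 * \<delta> = 3 / sqrt m" by (simp add: \<delta>_def)
    then show ?thesis using triv[of b] True ab \<delta> by linarith
  next
    case False
    define c where "c = a + \<delta>"
    have c: "a < c" "c < b" using False \<delta> by (auto simp: c_def)
    have lower: "sqrt m \<le> \<phi>' t" if t: "t \<in> {c..b}" for t
    proof -
      have "m * (t - a) \<le> \<phi>' t - \<phi>' a"
        by (rule deriv_ge_imp_growth[of _ _ _ \<phi>'']) (use t c d2 conv in auto)
      moreover have "m * \<delta> \<le> m * (t - a)"
        using t m by (intro mult_left_mono) (auto simp: c_def)
      ultimately show ?thesis using start m\<delta> by linarith
    qed
    have sm: "0 < sqrt m" using m by simp
    have pos: "0 < \<phi>' t" if "t \<in> {c..b}" for t
      using lower[OF that] sm by linarith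
    have "cmod (integral {c..b} (\<lambda>t. cis (\<phi> t))) \<le>
        1 / \<bar>\<phi>' c\<bar> + 1 / \<bar>\<phi>' b\<bar> + (- (1 / \<phi>' b) - (- (1 / \<phi>' c)))"
    proof (rule integral_cis_deriv_bound[where \<phi>''=\<phi>'' and g'="\<lambda>t. \<phi>'' t / (\<phi>' t)\<^sup>2" and g="\<lambda>t. - (1 / \<phi>' t)"])
      fix t assume t: "t \<in> {c..b}"
      then have tt: "t \<in> {a..b}" using c by auto
      show "(\<phi> has_real_derivative \<phi>' t) (at t)" "(\<phi>' has_real_derivative \<phi>'' t) (at t)"
        using d1[OF tt] d2[OF tt] by auto
      show nz: "\<phi>' t \<noteq> 0" using pos[OF t] by simp
      show "((\<lambda>t. - (1 / \<phi>' t)) has_real_derivative \<phi>'' t / (\<phi>' t)\<^sup>2) (at t)"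
        by (rule derivative_eq_intros refl d2[OF tt] nz)+ (simp add: power2_eq_square)
      show "\<bar>\<phi>'' t\<bar> / (\<phi>' t)\<^sup>2 \<le> \<phi>'' t / (\<phi>' t)\<^sup>2"
        using conv[OF tt] m by simp
    qed (use c in auto)
    also have "\<dots> = 2 / \<phi>' c" using pos[of c] pos[of b] c by simp
    also have "\<dots> \<le> 2 / sqrt m"
      using lower[of c] c sm by (intro divide_left_mono mult_pos_pos pos) auto
    finally have right: "cmod (integral {c..b} (\<lambda>t. cis (\<phi> t))) \<le> 2 / sqrt m" .
    have "integral {a..b} (\<lambda>t. cis (\<phi> t)) =
        integral {a..c} (\<lambda>t. cis (\<phi> t)) + integral {c..b} (\<lambda>t. cis (\<phi> t))"
      using c by (intro Henstock_Kurzweil_Integration.integral_combine[symmetric]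
          integrable_continuous_interval cont) auto
    then have "cmod (integral {a..b} (\<lambda>t. cis (\<phi> t))) \<le> (c - a) + 2 / sqrt m"
      using triv[of c] c right norm_triangle_ineq[of "integral {a..c} (\<lambda>t. cis (\<phi> t))" "integral {c..b} (\<lambda>t. cis (\<phi> t))"]
      by simp
    also have "\<dots> = 3 / sqrt m" by (simp add: c_def \<delta>_def)
    finally show ?thesis .
  qed
qed

text \<open>
  The derivative of a strictly convex phase vanishes at most once. Cutting there, or at an endpoint if
  it has constant sign, leaves two pieces that are one-sided, the left one after reflection.
\<close>

lemma van_der_Corput:
  fixes \<phi> \<phi>' \<phi>'' :: "real \<Rightarrow> real"
  assumes ab: "a \<le> b" and m: "0 < m"
    and d1: "\<And>t. t \<in> {a..b} \<Longrightarrow> (\<phi> has_real_derivative \<phi>' t) (at t)"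
    and d2: "\<And>t. t \<in> {a..b} \<Longrightarrow> (\<phi>' has_real_derivative \<phi>'' t) (at t)"
    and conv: "\<And>t. t \<in> {a..b} \<Longrightarrow> m \<le> \<phi>'' t"
  shows "cmod (integral {a..b} (\<lambda>t. cis (\<phi> t))) \<le> 6 / sqrt m"
proof -
  have "continuous_on {a..b} \<phi>'"
    using d2 by (intro continuous_at_imp_continuous_on ballI) (auto intro: DERIV_isCont)
  then obtain c where c: "c \<in> {a..b}" and right: "c = b \<or> 0 \<le> \<phi>' c" and left: "c = a \<or> \<phi>' c \<le> 0"
    using IVT'[of \<phi>' a 0 b] ab
    by (metis atLeastAtMost_iff linorder_le_cases order_refl)
  have cont: "continuous_on {a..b} (\<lambda>t. cis (\<phi> t))"
    by (intro continuous_on_cis DERIV_atLeastAtMost_imp_continuous_on) (use d1 in auto)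
  have "cmod (integral {c..b} (\<lambda>t. cis (\<phi> t))) \<le> 3 / sqrt m"
  proof (cases "c = b")
    case False
    then show ?thesis
      using c right m by (intro van_der_Corput_half[of _ _ _ \<phi> \<phi>' \<phi>''] d1 d2 conv) auto
  qed (use m in simp)
  moreover have "cmod (integral {a..c} (\<lambda>t. cis (\<phi> t))) \<le> 3 / sqrt m"
  proof (cases "c = a")
    case False
    have "cmod (integral {-c..-a} (\<lambda>t. cis (\<phi> (- t)))) \<le> 3 / sqrt m"
    proof (rule van_der_Corput_half[where \<phi>'="\<lambda>t. - \<phi>' (- t)" and \<phi>''="\<lambda>t. \<phi>'' (- t)"])
      fix t assume t: "t \<in> {-c..-a}"
      then have tt: "- t \<in> {a..b}" using c by auto
      show "((\<lambda>t. \<phi> (- t)) has_real_derivative - \<phi>' (- t)) (at t)"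
        using DERIV_chain2[OF d1[OF tt] DERIV_minus[OF DERIV_ident]] by simp
      show "((\<lambda>t. - \<phi>' (- t)) has_real_derivative \<phi>'' (- t)) (at t)"
        using DERIV_minus[OF DERIV_chain2[OF d2[OF tt] DERIV_minus[OF DERIV_ident]]] by simp
      show "m \<le> \<phi>'' (- t)" by (rule conv[OF tt])
    qed (use c left False m in auto)
    then show ?thesis using Henstock_Kurzweil_Integration.integral_reflect_real[of c a "\<lambda>t. cis (\<phi> t)"] by simp
  qed (use m in simp)
  moreover have "integral {a..b} (\<lambda>t. cis (\<phi> t)) =
        integral {a..c} (\<lambda>t. cis (\<phi> t)) + integral {c..b} (\<lambda>t. cis (\<phi> t))"
    using c by (intro Henstock_Kurzweil_Integration.integral_combine[symmetric]
        integrable_continuous_interval cont) auto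
  ultimately show ?thesis
    using norm_triangle_ineq[of "integral {a..c} (\<lambda>t. cis (\<phi> t))" "integral {c..b} (\<lambda>t. cis (\<phi> t))"]
    by simp
qed

lemma one_minus_cos_le: "1 - cos x \<le> x\<^sup>2 / 2" for x :: real
proof -
  have "\<bar>sin (x / 2)\<bar>\<^sup>2 \<le> \<bar>x / 2\<bar>\<^sup>2"
    by (intro power_mono abs_sin_x_le_abs_x) auto
  moreover have "1 - cos x = 2 * (sin (x / 2))\<^sup>2"
    using cos_double_sin[of "x / 2"] by simp
  ultimately show ?thesis by (simp add: power_divide)
qed

lemma norm_cis_minus_one_le: "norm (cis u - 1) \<le> \<bar>u\<bar>"
proof -
  have "(norm (cis u - 1))\<^sup>2 = (cos u - 1)\<^sup>2 + (sin u)\<^sup>2" by (simp add: cmod_power2)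
  also have "\<dots> = 2 * (1 - cos u)"
    using sin_cos_squared_add2[of u] by (simp add: power2_eq_square algebra_simps)
  also have "\<dots> \<le> \<bar>u\<bar>\<^sup>2" using one_minus_cos_le[of u] by simp
  finally show ?thesis by (rule power2_le_imp_le) simp
qed

lemma one_minus_cos_ge:
  fixes x :: real
  assumes "0 \<le> x" "x \<le> 1 / 2"
  shows "x\<^sup>2 / 4 \<le> 1 - cos x"
proof -
  have cos: "1 / 2 \<le> cos y" if "0 \<le> y" "y \<le> 1 / 2" for y :: real
  proof -
    have "y\<^sup>2 \<le> (1 / 2)\<^sup>2" using that by (intro power_mono) auto
    then show ?thesis using one_minus_cos_le[of y] by (simp add: power_divide)
  qed
  have sin: "y / 2 \<le> sin y" if "0 \<le> y" "y \<le> 1 / 2" for y :: real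
    using deriv_ge_imp_growth[of 0 y sin cos "1 / 2"] that cos by (auto intro: derivative_eq_intros)
  have "0 * (x - 0) \<le> (1 - cos x - x\<^sup>2 / 4) - (1 - cos 0 - 0\<^sup>2 / 4)"
    by (rule deriv_ge_imp_growth[where f="\<lambda>y. 1 - cos y - y\<^sup>2 / 4" and f'="\<lambda>y. sin y - y / 2"])
      (use assms sin in \<open>auto intro!: derivative_eq_intros\<close>)
  then show ?thesis by simp
qed

lemma deriv_nonneg_imp_le:
  fixes f f' :: "real \<Rightarrow> real"
  assumes "a < b" "continuous_on {a..b} f"
    and "\<And>t. a < t \<Longrightarrow> t < b \<Longrightarrow> (f has_real_derivative f' t) (at t)"
    and "\<And>t. a < t \<Longrightarrow> t < b \<Longrightarrow> 0 \<le> f' t"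
  shows "f a \<le> f b"
proof -
  obtain l z where z: "a < z" "z < b" "DERIV f z :> l" "f b - f a = (b - a) * l"
    using MVT[OF assms(1,2)] assms(3) real_differentiable_def by blast
  have "l = f' z" using z assms(3) DERIV_unique by blast
  then have "0 \<le> (b - a) * l" using z assms(1,4) by (intro mult_nonneg_nonneg) auto
  then show ?thesis using z by simp
qed

text \<open>
  In this and the next identity \<open>s\<close> is the distance to the stationary point. The left sides are what
  the Taylor bounds on \<open>\<psi>\<close> and \<open>\<psi>'\<close> give for \<open>(1 - cos \<psi>) / \<psi>'\<close> from above and for
  \<open>(1 - cos \<psi>) \<psi>'' / \<psi>'\<^sup>2\<close> from below.
\<close>

lemma remainder_bound_identity:
  fixes m s K :: real
  assumes "0 < m" "0 < s"
  shows "(K * s\<^sup>2 / 2)\<^sup>2 / 2 / (m * s) = K\<^sup>2 / (8 * m) * s ^ 3"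
  using assms by (simp add: field_simps eval_nat_numeral)

lemma growth_rate_identity:
  fixes m s K :: real
  assumes "0 < K" "0 < s"
  shows "(m * s\<^sup>2 / 2)\<^sup>2 / 4 * m / (K * s)\<^sup>2 = m ^ 3 * s\<^sup>2 / (16 * K\<^sup>2)"
  using assms by (simp add: field_simps eval_nat_numeral)

text \<open>
  The function \<open>G = \<integral> sin \<psi> - (1 - cos \<psi>) / \<psi>'\<close> has the nonnegative derivative
  \<open>(1 - cos \<psi>) \<psi>'' / \<psi>'\<^sup>2\<close> and vanishes at the stationary point. So the oscillation after the first
  \<open>1 / sqrt K\<close> never undoes the gain made before, and that gain can be estimated because the
  phase is still at most \<open>1 / 2\<close> there.
\<close>

lemma integral_sin_stationary_half_ge:
  fixes \<psi> \<psi>' \<psi>'' :: "real \<Rightarrow> real"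
  assumes m: "0 < m"
    and d1: "\<And>t. t \<in> {a..b} \<Longrightarrow> (\<psi> has_real_derivative \<psi>' t) (at t)"
    and d2: "\<And>t. t \<in> {a..b} \<Longrightarrow> (\<psi>' has_real_derivative \<psi>'' t) (at t)"
    and lo: "\<And>t. t \<in> {a..b} \<Longrightarrow> m \<le> \<psi>'' t"
    and hi: "\<And>t. t \<in> {a..b} \<Longrightarrow> \<psi>'' t \<le> K"
    and start: "\<psi> a = 0" "\<psi>' a = 0"
    and long: "a + 1 / sqrt K \<le> b"
    and K: "0 < K"
  shows "(m / K) ^ 3 / (48 * sqrt K) \<le> integral {a..b} (\<lambda>t. sin (\<psi> t))"
proof -
  define c where "c = a + 1 / sqrt K"
  have c: "a < c" "c \<le> b" using long K by (auto simp: c_def)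
  have p1: "m * (t - a) \<le> \<psi>' t" "\<psi>' t \<le> K * (t - a)" if t: "t \<in> {a..b}" for t
  proof -
    show "m * (t - a) \<le> \<psi>' t"
      using deriv_ge_imp_growth[of a t \<psi>' \<psi>'' m] t d2 lo start by auto
    have "- K * (t - a) \<le> - \<psi>' t - (- \<psi>' a)"
      by (rule deriv_ge_imp_growth[of a t "\<lambda>t. - \<psi>' t" "\<lambda>t. - \<psi>'' t"])
        (use t d2 hi in \<open>auto intro!: derivative_intros\<close>)
    then show "\<psi>' t \<le> K * (t - a)" using start by simp
  qed
  have p0: "m * (t - a)\<^sup>2 / 2 \<le> \<psi> t" "\<psi> t \<le> K * (t - a)\<^sup>2 / 2" if t: "t \<in> {a..b}" for t
  proof -
    have "0 * (t - a) \<le> (\<psi> t - m * (t - a)\<^sup>2 / 2) - (\<psi> a - m * (a - a)\<^sup>2 / 2)"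
      by (rule deriv_ge_imp_growth[of a t "\<lambda>t. \<psi> t - m * (t - a)\<^sup>2 / 2" "\<lambda>t. \<psi>' t - m * (t - a)"])
        (use t p1 in \<open>auto intro!: derivative_eq_intros d1 simp: diff_divide_distrib right_diff_distrib\<close>)
    then show "m * (t - a)\<^sup>2 / 2 \<le> \<psi> t" using start by simp
    have "0 * (t - a) \<le> (K * (t - a)\<^sup>2 / 2 - \<psi> t) - (K * (a - a)\<^sup>2 / 2 - \<psi> a)"
      by (rule deriv_ge_imp_growth[of a t "\<lambda>t. K * (t - a)\<^sup>2 / 2 - \<psi> t" "\<lambda>t. K * (t - a) - \<psi>' t"])
        (use t p1 in \<open>auto intro!: derivative_eq_intros d1 simp: diff_divide_distrib right_diff_distrib\<close>)
    then show "\<psi> t \<le> K * (t - a)\<^sup>2 / 2" using start by simp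
  qed
  have pos: "0 < \<psi>' t" if "a < t" "t \<le> b" for t
  proof -
    have "0 < m * (t - a)" using m that by simp
    then show ?thesis using p1[of t] that by simp
  qed
  \<comment> \<open>At \<open>a\<close> this is \<open>0 / 0 = 0\<close>, which is also the limit.\<close>
  define Q where "Q t = (1 - cos (\<psi> t)) / \<psi>' t" for t
  define G where "G t = integral {a..t} (\<lambda>s. sin (\<psi> s)) - Q t" for t
  have cont1: "continuous_on {a..b} \<psi>" "continuous_on {a..b} \<psi>'"
    by (intro DERIV_atLeastAtMost_imp_continuous_on; use d1 d2 in force)+
  have sinc: "continuous_on {a..b} (\<lambda>t. sin (\<psi> t))"
    by (intro continuous_intros cont1)
  have Qa: "Q a = 0" by (simp add: Q_def start)
  have Qle: "\<bar>Q t\<bar> \<le> K\<^sup>2 / (8 * m) * (t - a) ^ 3" if t: "a < t" "t \<le> b" for t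
  proof -
    have "0 \<le> m * (t - a)\<^sup>2 / 2" using m by simp
    then have "0 \<le> \<psi> t" using p0(1)[of t] t by simp
    then have "(\<psi> t)\<^sup>2 \<le> (K * (t - a)\<^sup>2 / 2)\<^sup>2"
      using p0(2)[of t] t by (intro power_mono) auto
    then have "1 - cos (\<psi> t) \<le> (K * (t - a)\<^sup>2 / 2)\<^sup>2 / 2"
      using one_minus_cos_le[of "\<psi> t"] by simp
    then have "Q t \<le> (K * (t - a)\<^sup>2 / 2)\<^sup>2 / 2 / (m * (t - a))"
      unfolding Q_def
    proof (rule frac_le[rotated])
      show "0 < m * (t - a)" using m t by simp
      show "m * (t - a) \<le> \<psi>' t" using p1(1) t by simp
    qed simp
    also have "\<dots> = K\<^sup>2 / (8 * m) * (t - a) ^ 3"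
      by (rule remainder_bound_identity) (use m t in simp_all)
    finally show ?thesis using pos[OF t] by (simp add: Q_def)
  qed
  have Qc: "continuous (at t within {a..b}) Q" if t: "t \<in> {a..b}" for t
  proof (cases "t = a")
    case True
    have "((\<lambda>t. K\<^sup>2 / (8 * m) * (t - a) ^ 3) \<longlongrightarrow> K\<^sup>2 / (8 * m) * (a - a) ^ 3) (at a within {a..b})"
      by (intro tendsto_intros)
    then have "((\<lambda>t. K\<^sup>2 / (8 * m) * (t - a) ^ 3) \<longlongrightarrow> 0) (at a within {a..b})" by simp
    moreover have "\<forall>\<^sub>F t in at a within {a..b}. norm (Q t) \<le> K\<^sup>2 / (8 * m) * (t - a) ^ 3"
      unfolding eventually_at_filter
    proof (rule always_eventually, intro allI impI)
      fix t assume "t \<noteq> a" "t \<in> {a..b}"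
      then show "norm (Q t) \<le> K\<^sup>2 / (8 * m) * (t - a) ^ 3" using Qle[of t] by simp
    qed
    ultimately have "(Q \<longlongrightarrow> 0) (at a within {a..b})"
      by (rule Lim_null_comparison[rotated])
    then show ?thesis using True Qa by (simp add: continuous_within)
  next
    case False
    then show ?thesis
      unfolding Q_def using pos[of t] t cont1
      by (intro continuous_at_within_divide continuous_diff continuous_const continuous_cos)
        (auto simp: continuous_on_eq_continuous_within)
  qed
  have Gc: "continuous_on {a..b} G"
    unfolding G_def using Qc
    by (intro continuous_on_diff indefinite_integral_continuous_1 integrable_continuous_interval sinc)
      (auto simp: continuous_on_eq_continuous_within)
  have dG: "(G has_real_derivative (1 - cos (\<psi> t)) * \<psi>'' t / (\<psi>' t)\<^sup>2) (at t)"
    if t: "a < t" "t < b" for t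
  proof -
    have tt: "t \<in> {a..b}" using t by simp
    have nz: "\<psi>' t \<noteq> 0" using pos[of t] t by simp
    have "(Q has_real_derivative (((0 - - sin (\<psi> t) * \<psi>' t) * \<psi>' t - (1 - cos (\<psi> t)) * \<psi>'' t) / (\<psi>' t * \<psi>' t))) (at t)"
      unfolding Q_def
      by (intro DERIV_divide DERIV_diff DERIV_const DERIV_fun_cos d1[OF tt] d2[OF tt] nz)
    moreover have "((\<lambda>t. integral {a..t} (\<lambda>s. sin (\<psi> s))) has_real_derivative sin (\<psi> t)) (at t)"
      using integral_has_real_derivative[OF sinc tt] t by (simp add: at_within_Icc_at)
    ultimately have "(G has_real_derivative sin (\<psi> t) - (((0 - - sin (\<psi> t) * \<psi>' t) * \<psi>' t - (1 - cos (\<psi> t)) * \<psi>'' t) / (\<psi>' t * \<psi>' t))) (at t)"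
      unfolding G_def by (intro DERIV_diff)
    then show ?thesis
      by (rule DERIV_cong) (use nz in \<open>simp add: field_simps power2_eq_square\<close>)
  qed
  have "G a - m ^ 3 * (a - a) ^ 3 / (48 * K\<^sup>2) \<le> G c - m ^ 3 * (c - a) ^ 3 / (48 * K\<^sup>2)"
  proof (rule deriv_nonneg_imp_le[where f="\<lambda>t. G t - m ^ 3 * (t - a) ^ 3 / (48 * K\<^sup>2)"
        and f'="\<lambda>t. (1 - cos (\<psi> t)) * \<psi>'' t / (\<psi>' t)\<^sup>2 - m ^ 3 * (t - a)\<^sup>2 / (16 * K\<^sup>2)"])
    show "a < c" by (rule c)
    show "continuous_on {a..c} (\<lambda>t. G t - m ^ 3 * (t - a) ^ 3 / (48 * K\<^sup>2))"
      using continuous_on_subset[OF Gc, of "{a..c}"] c K by (intro continuous_intros) auto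
    fix t assume t: "a < t" "t < c"
    show "((\<lambda>t. G t - m ^ 3 * (t - a) ^ 3 / (48 * K\<^sup>2)) has_real_derivative
        (1 - cos (\<psi> t)) * \<psi>'' t / (\<psi>' t)\<^sup>2 - m ^ 3 * (t - a)\<^sup>2 / (16 * K\<^sup>2)) (at t)"
    proof (rule DERIV_diff)
      show "(G has_real_derivative (1 - cos (\<psi> t)) * \<psi>'' t / (\<psi>' t)\<^sup>2) (at t)"
        using t c by (intro dG) auto
      have "((\<lambda>t. m ^ 3 * (t - a) ^ 3 / (48 * K\<^sup>2)) has_real_derivative m ^ 3 * (3 * (t - a)\<^sup>2) / (48 * K\<^sup>2)) (at t)"
        by (rule derivative_eq_intros refl)+ (use K in \<open>simp_all add: power4_eq_xxxx power2_eq_square\<close>)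
      then show "((\<lambda>t. m ^ 3 * (t - a) ^ 3 / (48 * K\<^sup>2)) has_real_derivative m ^ 3 * (t - a)\<^sup>2 / (16 * K\<^sup>2)) (at t)"
        by simp
    qed
    have tt: "t \<in> {a..b}" "a < t" "t \<le> b" using t c by auto
    have "K * (t - a)\<^sup>2 \<le> K * (1 / sqrt K)\<^sup>2"
      using t K by (intro mult_left_mono power_mono) (auto simp: c_def)
    then have "K * (t - a)\<^sup>2 \<le> 1" using K by (simp add: power_divide)
    then have "\<psi> t \<le> 1 / 2" using p0(2)[OF tt(1)] by simp
    moreover have lower: "0 \<le> m * (t - a)\<^sup>2 / 2" using m by simp
    ultimately have "(\<psi> t)\<^sup>2 / 4 \<le> 1 - cos (\<psi> t)"
      using p0(1)[OF tt(1)] by (intro one_minus_cos_ge) auto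
    moreover have "(m * (t - a)\<^sup>2 / 2)\<^sup>2 \<le> (\<psi> t)\<^sup>2"
      using p0(1)[OF tt(1)] lower by (intro power_mono) auto
    ultimately have "(m * (t - a)\<^sup>2 / 2)\<^sup>2 / 4 \<le> 1 - cos (\<psi> t)" by simp
    then have num: "(m * (t - a)\<^sup>2 / 2)\<^sup>2 / 4 * m \<le> (1 - cos (\<psi> t)) * \<psi>'' t"
      using lo[OF tt(1)] m by (intro mult_mono) simp_all
    have den: "(\<psi>' t)\<^sup>2 \<le> (K * (t - a))\<^sup>2"
      using p1(2)[OF tt(1)] pos[OF tt(2,3)] by (intro power_mono) auto
    have quot: "(m * (t - a)\<^sup>2 / 2)\<^sup>2 / 4 * m / (K * (t - a))\<^sup>2
        \<le> (1 - cos (\<psi> t)) * \<psi>'' t / (\<psi>' t)\<^sup>2"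
    proof (rule frac_le[OF _ num _ den])
      show "0 < (\<psi>' t)\<^sup>2" using pos[OF tt(2,3)] by simp
      show "0 \<le> (1 - cos (\<psi> t)) * \<psi>'' t"
        using m lo[OF tt(1)] by (intro mult_nonneg_nonneg) simp_all
    qed
    have "(m * (t - a)\<^sup>2 / 2)\<^sup>2 / 4 * m / (K * (t - a))\<^sup>2 = m ^ 3 * (t - a)\<^sup>2 / (16 * K\<^sup>2)"
      by (rule growth_rate_identity) (use K t in simp_all)
    then show "0 \<le> (1 - cos (\<psi> t)) * \<psi>'' t / (\<psi>' t)\<^sup>2 - m ^ 3 * (t - a)\<^sup>2 / (16 * K\<^sup>2)"
      using quot by (simp only: diff_ge_0_iff_ge)
  qed
  moreover have "G a = 0" by (simp add: G_def Qa)
  moreover have "m ^ 3 * (c - a) ^ 3 / (48 * K\<^sup>2) = (m / K) ^ 3 / (48 * sqrt K)"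
  proof -
    have "(c - a) ^ 3 = 1 / (K * sqrt K)" using K by (simp add: c_def power_divide power3_eq_cube)
    then show ?thesis using K by (simp add: power_divide power3_eq_cube power2_eq_square)
  qed
  ultimately have "(m / K) ^ 3 / (48 * sqrt K) \<le> G c" by simp
  also have "G c \<le> G b"
  proof (cases "c = b")
    case False
    show ?thesis
    proof (rule deriv_nonneg_imp_le[of c b G "\<lambda>t. (1 - cos (\<psi> t)) * \<psi>'' t / (\<psi>' t)\<^sup>2"])
      fix t assume t: "c < t" "t < b"
      then show "(G has_real_derivative (1 - cos (\<psi> t)) * \<psi>'' t / (\<psi>' t)\<^sup>2) (at t)"
        using c by (intro dG) auto
      show "0 \<le> (1 - cos (\<psi> t)) * \<psi>'' t / (\<psi>' t)\<^sup>2"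
        using lo[of t] t c m by (intro divide_nonneg_nonneg mult_nonneg_nonneg) auto
    qed (use c False continuous_on_subset[OF Gc] in auto)
  qed simp
  also have "\<dots> \<le> integral {a..b} (\<lambda>t. sin (\<psi> t))"
    using pos[of b] c by (simp add: G_def Q_def)
  finally show ?thesis .
qed

text \<open>
  Relative to the phase at the stationary point, the imaginary parts of the two half integrals are
  both positive, so they cannot cancel.
\<close>

lemma integral_cis_stationary_ge:
  fixes \<psi> \<psi>' \<psi>'' :: "real \<Rightarrow> real"
  assumes m: "0 < m" and K: "0 < K"
    and c: "a + 1 / sqrt K \<le> c" "c + 1 / sqrt K \<le> b"
    and d1: "\<And>t. t \<in> {a..b} \<Longrightarrow> (\<psi> has_real_derivative \<psi>' t) (at t)"
    and d2: "\<And>t. t \<in> {a..b} \<Longrightarrow> (\<psi>' has_real_derivative \<psi>'' t) (at t)"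
    and lo: "\<And>t. t \<in> {a..b} \<Longrightarrow> m \<le> \<psi>'' t"
    and hi: "\<And>t. t \<in> {a..b} \<Longrightarrow> \<psi>'' t \<le> K"
    and stationary: "\<psi>' c = 0"
  shows "(m / K) ^ 3 / (24 * sqrt K) \<le> cmod (integral {a..b} (\<lambda>t. cis (\<psi> t)))"
proof -
  have pos: "0 < 1 / sqrt K" using K by simp
  have cab: "a < c" "c < b" using c pos by linarith+
  define \<eta> where "\<eta> t = \<psi> t - \<psi> c" for t
  have e1: "(\<eta> has_real_derivative \<psi>' t) (at t)" if "t \<in> {a..b}" for t
    unfolding \<eta>_def using d1[OF that] by (auto intro!: derivative_eq_intros)
  have right: "(m / K) ^ 3 / (48 * sqrt K) \<le> integral {c..b} (\<lambda>t. sin (\<eta> t))"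
    by (rule integral_sin_stationary_half_ge[of m c b \<eta> \<psi>' \<psi>''])
      (use assms cab e1 in \<open>auto simp: \<eta>_def\<close>)
  have "(m / K) ^ 3 / (48 * sqrt K) \<le> integral {-c..-a} (\<lambda>t. sin (\<eta> (- t)))"
  proof (rule integral_sin_stationary_half_ge[where \<psi>'="\<lambda>t. - \<psi>' (- t)" and \<psi>''="\<lambda>t. \<psi>'' (- t)"])
    fix t assume t: "t \<in> {-c..-a}"
    then have tt: "- t \<in> {a..b}" using cab by auto
    show "((\<lambda>t. \<eta> (- t)) has_real_derivative - \<psi>' (- t)) (at t)"
      using DERIV_chain2[OF e1[OF tt] DERIV_minus[OF DERIV_ident]] by simp
    show "((\<lambda>t. - \<psi>' (- t)) has_real_derivative \<psi>'' (- t)) (at t)"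
      using DERIV_minus[OF DERIV_chain2[OF d2[OF tt] DERIV_minus[OF DERIV_ident]]] by simp
    show "m \<le> \<psi>'' (- t)" "\<psi>'' (- t) \<le> K" using lo[OF tt] hi[OF tt] by auto
  qed (use assms cab in \<open>auto simp: \<eta>_def\<close>)
  then have left: "(m / K) ^ 3 / (48 * sqrt K) \<le> integral {a..c} (\<lambda>t. sin (\<eta> t))"
    using Henstock_Kurzweil_Integration.integral_reflect_real[of c a "\<lambda>t. sin (\<eta> t)"] by simp
  have cont: "continuous_on {a..b} \<eta>"
    by (rule DERIV_atLeastAtMost_imp_continuous_on) (use e1 in auto)
  have split: "integral {a..b} (\<lambda>t. sin (\<eta> t)) =
      integral {a..c} (\<lambda>t. sin (\<eta> t)) + integral {c..b} (\<lambda>t. sin (\<eta> t))"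
    using cab by (intro Henstock_Kurzweil_Integration.integral_combine[symmetric]
        integrable_continuous_interval continuous_intros cont) auto
  have int: "(\<lambda>t. cis (\<eta> t)) integrable_on {a..b}"
    by (intro integrable_continuous_interval continuous_intros cont)
  have "integral {a..b} (\<lambda>t. sin (\<eta> t)) = Im (integral {a..b} (\<lambda>t. cis (\<eta> t)))"
    using integral_linear[OF int bounded_linear_Im] by (simp add: o_def)
  also have "\<dots> \<le> cmod (integral {a..b} (\<lambda>t. cis (\<eta> t)))"
    using abs_Im_le_cmod[of "integral {a..b} (\<lambda>t. cis (\<eta> t))"] by linarith
  also have "(\<lambda>t. cis (\<eta> t)) = (\<lambda>t. cis (- \<psi> c) * cis (\<psi> t))"
    by (simp add: \<eta>_def cis_mult algebra_simps)
  finally have "integral {a..b} (\<lambda>t. sin (\<eta> t)) \<le> cmod (integral {a..b} (\<lambda>t. cis (\<psi> t)))"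
    by (simp add: norm_mult)
  then show ?thesis using left right split by simp
qed

section \<open>Sums of an inverse-distance weight\<close>

definition decay_weight :: "'a::real_normed_vector \<Rightarrow> real" where
  "decay_weight x = 1 / max 1 (norm x)"

lemma decay_weight_pos: "0 < decay_weight x"
  by (simp add: decay_weight_def)

text \<open>
  A translation by a fixed vector changes the weight by a bounded factor, hence keeps its sums finite.
\<close>

lemma decay_weight_shift: "decay_weight (x - y) \<le> (1 + norm y) * decay_weight x"
proof -
  have "norm x \<le> norm (x - y) + norm y"
    using norm_triangle_ineq[of "x - y" y] by simp
  also have "\<dots> \<le> max 1 (norm (x - y)) + norm y * max 1 (norm (x - y))"
    by (intro add_mono) (auto simp: mult_le_cancel_left1)
  finally have "norm x \<le> (1 + norm y) * max 1 (norm (x - y))"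
    by (simp add: algebra_simps)
  moreover have "1 * 1 \<le> (1 + norm y) * max 1 (norm (x - y))"
    by (intro mult_mono) auto
  ultimately have "max 1 (norm x) \<le> (1 + norm y) * max 1 (norm (x - y))" by simp
  then show ?thesis
    by (simp add: decay_weight_def field_simps)
qed

lemma decay_weight_le_2:
  assumes "2 * norm y \<le> norm x"
  shows "decay_weight (x - y) \<le> 2 * decay_weight x"
proof -
  have "norm x \<le> 2 * norm (x - y)"
    using norm_triangle_ineq[of "x - y" y] assms by simp
  then have "max 1 (norm x) \<le> 2 * max 1 (norm (x - y))" by linarith
  then show ?thesis
    by (simp add: decay_weight_def field_simps)
qed

lemma sqrt_diff_le:
  assumes "y \<le> x"
  shows "sqrt x - sqrt y \<le> 2 * sqrt (x - y)"
proof -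
  consider "0 \<le> y" | "x \<le> 0" | "y < 0" "0 < x" by linarith
  then show ?thesis
  proof cases
    case 1
    then have "sqrt x \<le> sqrt (x - y) + sqrt y"
      using assms sqrt_add_le_add_sqrt[of "x - y" y] by simp
    moreover have "0 \<le> sqrt (x - y)" using assms by simp
    ultimately show ?thesis by linarith
  next
    case 2
    then have "sqrt (- y) \<le> sqrt (x - y) + sqrt (- x)"
      using assms sqrt_add_le_add_sqrt[of "x - y" "- x"] by simp
    moreover have "0 \<le> sqrt (x - y)" using assms by simp
    moreover have "sqrt (- y) = - sqrt y" "sqrt (- x) = - sqrt x" by (simp_all add: real_sqrt_minus)
    ultimately show ?thesis by linarith
  next
    case 3
    then have "sqrt x \<le> sqrt (x - y)" "sqrt (- y) \<le> sqrt (x - y)"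
      by (auto intro!: real_sqrt_le_mono)
    moreover have "sqrt (- y) = - sqrt y" by (simp add: real_sqrt_minus)
    ultimately show ?thesis by linarith
  qed
qed

text \<open>
  Since \<open>sqrt\<close> is extended to an odd function, one antiderivative serves on both sides of the singularity and
  sums over integer translates will telescope.
\<close>

lemma inverse_sqrt_le_diff: "1 / sqrt (max 1 \<bar>u\<bar>) \<le> 3 * (sqrt (u + 1) - sqrt u)"
proof -
  have pos: "1 / sqrt (max 1 \<bar>u\<bar>) \<le> 3 * (sqrt (u + 1) - sqrt u)" if u: "0 \<le> u" for u :: real
  proof -
    define r where "r = max 1 u"
    have r: "1 \<le> r" "u + 1 \<le> 2 * r" "u \<le> r" by (auto simp: r_def)
    have "sqrt (u + 1) \<le> sqrt 2 * sqrt r"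
      using r by (simp flip: real_sqrt_mult)
    moreover have "sqrt 2 \<le> 2" using real_sqrt_le_mono[of 2 4] by simp
    then have "sqrt 2 * sqrt r \<le> 2 * sqrt r" using r by (intro mult_right_mono) auto
    ultimately have "sqrt (u + 1) + sqrt u \<le> 3 * sqrt r"
      using real_sqrt_le_mono[OF r(3)] by linarith
    moreover have "(sqrt (u + 1) - sqrt u) * (sqrt (u + 1) + sqrt u) = 1"
      using u by (simp add: algebra_simps)
    moreover have "0 \<le> sqrt (u + 1) - sqrt u" by simp
    ultimately have "1 \<le> (sqrt (u + 1) - sqrt u) * (3 * sqrt r)"
      by (metis mult_left_mono)
    then show ?thesis using r u by (simp add: field_simps r_def)
  qed
  consider "0 \<le> u" | "u \<le> -1" | "-1 < u" "u < 0" by linarith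
  then show ?thesis
  proof cases
    case 1 then show ?thesis by (rule pos)
  next
    case 2
    have "1 / sqrt (max 1 \<bar>u\<bar>) \<le> 1 / sqrt (max 1 \<bar>- u - 1\<bar>)"
      using 2 by (intro divide_left_mono real_sqrt_le_mono mult_pos_pos) auto
    also have "\<dots> \<le> 3 * (sqrt (- u - 1 + 1) - sqrt (- u - 1))"
      by (rule pos) (use 2 in simp)
    also have "sqrt (- u - 1) = - sqrt (u + 1)"
      using real_sqrt_minus[of "u + 1"] by simp
    finally show ?thesis by (simp add: real_sqrt_minus)
  next
    case 3
    have "sqrt ((u + 1) + (- u)) \<le> sqrt (u + 1) + sqrt (- u)"
      using 3 by (intro sqrt_add_le_add_sqrt) auto
    moreover have "max 1 \<bar>u\<bar> = 1" using 3 by auto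
    ultimately show ?thesis by (simp add: real_sqrt_minus)
  qed
qed

lemma sum_inverse_sqrt_le:
  "(\<Sum>j<n. 1 / sqrt (max 1 \<bar>a - real j\<bar>)) \<le> 6 * sqrt (real n)"
proof -
  have "(\<Sum>j<n. 1 / sqrt (max 1 \<bar>a - real j\<bar>)) \<le>
      (\<Sum>j<n. 3 * (sqrt (a - real j + 1) - sqrt (a - real j)))"
    by (intro sum_mono inverse_sqrt_le_diff)
  also have "\<dots> = 3 * (\<Sum>j<n. sqrt (a + 1 - real j) - sqrt (a + 1 - real (Suc j)))"
    by (simp add: sum_distrib_left algebra_simps)
  also have "\<dots> = 3 * (sqrt (a + 1) - sqrt (a + 1 - real n))"
    by (subst sum_lessThan_telescope') simp
  also have "\<dots> \<le> 3 * (2 * sqrt ((a + 1) - (a + 1 - real n)))"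
    by (intro mult_left_mono sqrt_diff_le) auto
  finally show ?thesis by simp
qed

text \<open>
  This separation of variables turns planar sums of the weight into products of one-dimensional sums.
  It loses nothing on average over a square, since both \<open>1 / |x|\<close> and \<open>|x\<^sub>1 x\<^sub>2| powr - (1 / 2)\<close> have
  integral of order \<open>n\<close> over a square of side \<open>n\<close>.
\<close>

lemma decay_weight_le_product:
  fixes x :: "real^2"
  shows "decay_weight x \<le> 1 / sqrt (max 1 \<bar>x $ 1\<bar>) * (1 / sqrt (max 1 \<bar>x $ 2\<bar>))"
proof -
  have "max 1 \<bar>x $ i\<bar> \<le> max 1 (norm x)" for i
    using component_le_norm_cart[of x i] by auto
  then have "sqrt (max 1 \<bar>x $ 1\<bar>) * sqrt (max 1 \<bar>x $ 2\<bar>) \<le> sqrt (max 1 (norm x)) * sqrt (max 1 (norm x))"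
    by (intro mult_mono real_sqrt_le_mono) auto
  then have "sqrt (max 1 \<bar>x $ 1\<bar>) * sqrt (max 1 \<bar>x $ 2\<bar>) \<le> max 1 (norm x)" by simp
  then have "1 / max 1 (norm x) \<le> 1 / (sqrt (max 1 \<bar>x $ 1\<bar>) * sqrt (max 1 \<bar>x $ 2\<bar>))"
    by (intro divide_left_mono mult_pos_pos) auto
  then show ?thesis by (simp add: decay_weight_def)
qed

definition grid_point :: "nat \<times> nat \<Rightarrow> real^2" where
  "grid_point p = vector [real (fst p), real (snd p)]"

lemma norm_grid_point_le:
  assumes "p \<in> {..<n} \<times> {..<n}"
  shows "norm (grid_point p) \<le> 2 * real n"
proof -
  have "norm (grid_point p) \<le> \<bar>grid_point p $ 1\<bar> + \<bar>grid_point p $ 2\<bar>"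
    using norm_le_l1_cart[of "grid_point p"] by (simp add: sum_2)
  also have "\<dots> \<le> 2 * real n" using assms by (auto simp: grid_point_def)
  finally show ?thesis .
qed

lemma sum_grid_le:
  "(\<Sum>p\<in>{..<n} \<times> {..<n}. decay_weight (x - grid_point p)) \<le> 36 * real n"
proof -
  have "(\<Sum>p\<in>{..<n} \<times> {..<n}. decay_weight (x - grid_point p)) \<le>
     (\<Sum>p\<in>{..<n} \<times> {..<n}. 1 / sqrt (max 1 \<bar>x $ 1 - real (fst p)\<bar>) * (1 / sqrt (max 1 \<bar>x $ 2 - real (snd p)\<bar>)))"
    using decay_weight_le_product[of "x - grid_point _"] by (intro sum_mono) (simp add: grid_point_def)
  also have "\<dots> = (\<Sum>j<n. 1 / sqrt (max 1 \<bar>x $ 1 - real j\<bar>)) * (\<Sum>j<n. 1 / sqrt (max 1 \<bar>x $ 2 - real j\<bar>))"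
    by (simp add: sum_product sum.cartesian_product case_prod_beta)
  also have "\<dots> \<le> (6 * sqrt (real n)) * (6 * sqrt (real n))"
    by (intro mult_mono sum_inverse_sqrt_le sum_nonneg) auto
  finally show ?thesis by simp
qed

text \<open>
  The averages over the grid are dominated by the weight uniformly in \<open>n\<close>. A point \<open>x\<close> with
  \<open>|x| > 4 n\<close> is so far from the grid that no translate changes its weight by more than a factor \<open>2\<close>.
  For the other points the bound \<open>36 / n\<close> on the average is already good enough.
\<close>

lemma sum_grid_le_decay_weight:
  fixes x :: "real^2"
  assumes n: "0 < n"
  shows "(\<Sum>p\<in>{..<n} \<times> {..<n}. decay_weight (x - grid_point p)) \<le> (real n)\<^sup>2 * (144 * decay_weight x)"
proof (cases "norm x \<le> 4 * real n")
  case True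
  then have "max 1 (norm x) \<le> 4 * real n" using n by simp
  then have "1 \<le> 4 * real n * decay_weight x" by (simp add: decay_weight_def field_simps)
  then have "36 * real n * 1 \<le> 36 * real n * (4 * real n * decay_weight x)"
    by (intro mult_left_mono) auto
  then show ?thesis using sum_grid_le[of x n] by (simp add: power2_eq_square)
next
  case False
  have "(\<Sum>p\<in>{..<n} \<times> {..<n}. decay_weight (x - grid_point p)) \<le> (\<Sum>p\<in>{..<n} \<times> {..<n}. 2 * decay_weight x)"
    using norm_grid_point_le False by (intro sum_mono decay_weight_le_2) fastforce
  also have "\<dots> = (real n)\<^sup>2 * (2 * decay_weight x)" by (simp add: power2_eq_square)
  also have "\<dots> \<le> (real n)\<^sup>2 * (144 * decay_weight x)"
    using decay_weight_pos[of x] by (intro mult_left_mono) auto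
  finally show ?thesis .
qed

lemma decay_weight_translate_summable:
  assumes "decay_weight summable_on A"
  shows "(\<lambda>l. decay_weight (l - \<xi>)) summable_on A"
proof -
  have "(\<lambda>l. (1 + norm \<xi>) * decay_weight l) summable_on A"
    using assms by (rule summable_on_cmult_right)
  then show ?thesis
    by (rule summable_on_comparison_test) (auto intro: decay_weight_shift less_imp_le[OF decay_weight_pos])
qed

lemma has_sum_sum_finite:
  fixes f :: "'a \<Rightarrow> 'b \<Rightarrow> real"
  assumes "finite X" "\<And>p. p \<in> X \<Longrightarrow> (f p has_sum s p) A"
  shows "((\<lambda>x. \<Sum>p\<in>X. f p x) has_sum (\<Sum>p\<in>X. s p)) A"
  using assms by (induction X rule: finite_induct) (auto intro!: has_sum_add)

text \<open>
  Dominated convergence for the averages over the grid. A finite subset of \<open>\<Lambda>\<close> carries all but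
  little of \<open>\<Sum> w\<close>. On it the averages are at most \<open>36 / n\<close>, on the rest at most \<open>144 w\<close>.
\<close>

lemma translated_decay_weight_sums_not_bounded_below:
  fixes \<Lambda> :: "(real^2) set"
  assumes sum: "decay_weight summable_on \<Lambda>" and \<beta>: "0 < \<beta>"
  shows "\<exists>\<xi>. (\<Sum>\<^sub>\<infinity>l\<in>\<Lambda>. decay_weight (l - \<xi>)) < \<beta>"
proof (rule ccontr)
  assume "\<not> ?thesis"
  then have low: "\<beta> \<le> (\<Sum>\<^sub>\<infinity>l\<in>\<Lambda>. decay_weight (l - \<xi>))" for \<xi>
    by (meson not_le)
  have shift: "(\<lambda>l. decay_weight (l - \<xi>)) summable_on A" if "A \<subseteq> \<Lambda>" for \<xi> A
    by (rule decay_weight_translate_summable[OF summable_on_subset[OF sum that]])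
  obtain F where F: "finite F" "F \<subseteq> \<Lambda>"
    and d: "dist (sum decay_weight F) (infsum decay_weight \<Lambda>) \<le> \<beta> / (4 * 144)"
    using infsum_finite_approximation[OF sum, of "\<beta> / (4 * 144)"] \<beta> by auto
  have sumD: "decay_weight summable_on (\<Lambda> - F)" by (rule summable_on_subset[OF sum]) auto
  have "infsum decay_weight \<Lambda> = sum decay_weight F + infsum decay_weight (\<Lambda> - F)"
    using infsum_Un_disjoint[of decay_weight F "\<Lambda> - F"] F sumD
    by (simp add: Un_absorb1)
  then have tail: "infsum decay_weight (\<Lambda> - F) \<le> \<beta> / (4 * 144)"
    using d by (simp add: dist_real_def)
  obtain n where n: "4 * 36 * real (card F) / \<beta> < real n" using reals_Archimedean2 by blast
  have n0: "0 < n" using n \<beta> by (cases n) (auto simp: divide_less_0_iff)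
  let ?X = "{..<n} \<times> {..<n}"
  \<comment> \<open>Add the assumed lower bounds over all grid points and split \<open>\<Lambda>\<close> into \<open>F\<close> and its complement.\<close>
  have "(real n)\<^sup>2 * \<beta> = (\<Sum>p\<in>?X. \<beta>)" by (simp add: power2_eq_square)
  also have "\<dots> \<le> (\<Sum>p\<in>?X. \<Sum>\<^sub>\<infinity>l\<in>\<Lambda>. decay_weight (l - grid_point p))"
    by (intro sum_mono low)
  also have "\<dots> = (\<Sum>p\<in>?X. (\<Sum>l\<in>F. decay_weight (l - grid_point p)) + (\<Sum>\<^sub>\<infinity>l\<in>\<Lambda>-F. decay_weight (l - grid_point p)))"
  proof (intro sum.cong refl)
    fix p
    show "(\<Sum>\<^sub>\<infinity>l\<in>\<Lambda>. decay_weight (l - grid_point p)) = (\<Sum>l\<in>F. decay_weight (l - grid_point p)) + (\<Sum>\<^sub>\<infinity>l\<in>\<Lambda>-F. decay_weight (l - grid_point p))"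
      using infsum_Un_disjoint[of "\<lambda>l. decay_weight (l - grid_point p)" F "\<Lambda> - F"] F shift[of "\<Lambda> - F"]
      by (simp add: Un_absorb1)
  qed
  also have "\<dots> = (\<Sum>l\<in>F. \<Sum>p\<in>?X. decay_weight (l - grid_point p)) + (\<Sum>p\<in>?X. \<Sum>\<^sub>\<infinity>l\<in>\<Lambda>-F. decay_weight (l - grid_point p))"
    by (simp only: sum.distrib sum.swap[of _ F])
  also have "\<dots> \<le> real (card F) * (36 * real n) + (real n)\<^sup>2 * (144 * infsum decay_weight (\<Lambda> - F))"
  proof (intro add_mono)
    show "(\<Sum>l\<in>F. \<Sum>p\<in>?X. decay_weight (l - grid_point p)) \<le> real (card F) * (36 * real n)"
      by (rule sum_bounded_above) (rule sum_grid_le)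
    have "((\<lambda>l. \<Sum>p\<in>?X. decay_weight (l - grid_point p)) has_sum
        (\<Sum>p\<in>?X. \<Sum>\<^sub>\<infinity>l\<in>\<Lambda>-F. decay_weight (l - grid_point p))) (\<Lambda> - F)"
      by (intro has_sum_sum_finite has_sum_infsum shift) auto
    moreover have "((\<lambda>l. (real n)\<^sup>2 * (144 * decay_weight l)) has_sum (real n)\<^sup>2 * (144 * infsum decay_weight (\<Lambda> - F))) (\<Lambda> - F)"
      by (intro has_sum_cmult_right has_sum_infsum sumD)
    ultimately show "(\<Sum>p\<in>?X. \<Sum>\<^sub>\<infinity>l\<in>\<Lambda>-F. decay_weight (l - grid_point p)) \<le> (real n)\<^sup>2 * (144 * infsum decay_weight (\<Lambda> - F))"
      by (rule has_sum_mono) (rule sum_grid_le_decay_weight[OF n0])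
  qed
  also have "\<dots> < (real n)\<^sup>2 * \<beta>"
  proof -
    have "4 * 36 * real (card F) \<le> real n * \<beta>" using n \<beta> by (simp add: field_simps)
    then have "real n * (4 * 36 * real (card F)) \<le> real n * (real n * \<beta>)"
      by (intro mult_left_mono) auto
    then have "real (card F) * (36 * real n) \<le> (real n)\<^sup>2 * \<beta> / 4"
      by (simp add: power2_eq_square algebra_simps)
    moreover have "(real n)\<^sup>2 * (144 * infsum decay_weight (\<Lambda> - F)) \<le> (real n)\<^sup>2 * (\<beta> / 4)"
      using tail by (intro mult_left_mono) auto
    moreover have "0 < (real n)\<^sup>2 * \<beta>" using n0 \<beta> by simp
    ultimately show ?thesis by simp
  qed
  finally show False by simp
qed

section \<open>From tight frames to Fourier transforms of arcs\<close>

definition arc_transform :: "(real \<Rightarrow> real^2) \<Rightarrow> real \<Rightarrow> real \<Rightarrow> real^2 \<Rightarrow> complex" where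
  "arc_transform \<gamma> a b x = integral {a..b} (\<lambda>t. cis (- (2 * pi) * (x \<bullet> \<gamma> t)))"

lemma integral_arc_length_measure_borel:
  fixes \<gamma> :: "real \<Rightarrow> 'a::euclidean_space" and f :: "'a \<Rightarrow> 'b::{banach, second_countable_topology}"
  assumes "smooth_closed_curve L \<gamma>" and f: "f \<in> borel_measurable borel"
  shows "(\<integral>x. f x \<partial>arc_length_measure L \<gamma>) = (1 / L) *\<^sub>R (LINT t:{0..L}|lborel. f (\<gamma> t))"
proof -
  have L: "0 < L" using assms(1) by (simp add: smooth_closed_curve_def)
  have m: "\<gamma> \<in> borel_measurable (restrict_space lborel {0..L})"
    by (rule measurable_restrict_lborel[OF smooth_closed_curve_continuous_on[OF assms(1)]])
  let ?D = "distr (restrict_space lborel {0..L}) borel \<gamma>"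
  have "arc_length_measure L \<gamma> = density ?D (\<lambda>_. ennreal (1 / L))"
    unfolding arc_length_measure_def
    by (rule measure_eqI) (auto simp: emeasure_density_const)
  then have "(\<integral>x. f x \<partial>arc_length_measure L \<gamma>) = (\<integral>x. (1 / L) *\<^sub>R f x \<partial>?D)"
    using L f by (simp add: integral_density)
  also have "\<dots> = (1 / L) *\<^sub>R (\<integral>x. f x \<partial>?D)" by (rule integral_scaleR_right)
  also have "(\<integral>x. f x \<partial>?D) = (\<integral>t. f (\<gamma> t) \<partial>restrict_space lborel {0..L})"
    using m f by (rule integral_distr)
  also have "\<dots> = (LINT t:{0..L}|lborel. f (\<gamma> t))"
    by (simp add: integral_restrict_space set_lebesgue_integral_def)
  finally show ?thesis .
qed

text \<open>
  A parameter outside \<open>[a, b]\<close> that is mapped into the arc is a preimage of a self-intersection point,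
  except for \<open>L\<close>, which is left out of the fundamental domain \<open>[0, L)\<close>.
\<close>

lemma finite_arc_overlap:
  assumes ab: "0 < a" "b < L"
    and fin: "finite (self_intersection_points L \<gamma>)"
    and trans: "\<forall>x\<in>self_intersection_points L \<gamma>. transverse_at L \<gamma> x"
  shows "finite {t \<in> {0..L}. \<gamma> t \<in> \<gamma> ` {a..b} \<and> t \<notin> {a..b}}"
proof (rule finite_subset)
  show "{t \<in> {0..L}. \<gamma> t \<in> \<gamma> ` {a..b} \<and> t \<notin> {a..b}} \<subseteq>
      insert L (\<Union>x\<in>self_intersection_points L \<gamma>. {s \<in> {0..<L}. \<gamma> s = x})"
  proof
    fix t assume "t \<in> {t \<in> {0..L}. \<gamma> t \<in> \<gamma> ` {a..b} \<and> t \<notin> {a..b}}"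
    then obtain s where t: "0 \<le> t" "t \<le> L" "t \<notin> {a..b}" and s: "s \<in> {a..b}" "\<gamma> t = \<gamma> s" by auto
    show "t \<in> insert L (\<Union>x\<in>self_intersection_points L \<gamma>. {s \<in> {0..<L}. \<gamma> s = x})"
    proof (cases "t = L")
      case False
      have "s \<in> {0..<L}" "t \<in> {0..<L}" "s \<noteq> t" using t s ab False by auto
      then have "\<gamma> t \<in> self_intersection_points L \<gamma>"
        using s(2)[symmetric] unfolding self_intersection_points_def by blast
      then show ?thesis using \<open>t \<in> {0..<L}\<close> by auto
    qed simp
  qed
  show "finite (insert L (\<Union>x\<in>self_intersection_points L \<gamma>. {s \<in> {0..<L}. \<gamma> s = x}))"
    using fin trans by (auto simp: transverse_at_def)
qed

text \<open>
  A function on the plane sees the curve only as a set. Cutting off to the set \<open>\<gamma>[a, b]\<close> is the same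
  as restricting the parameter to \<open>[a, b]\<close>, up to the finite overlap.
\<close>

lemma integral_arc:
  fixes h :: "real^2 \<Rightarrow> 'b::euclidean_space"
  assumes \<gamma>: "smooth_closed_curve L \<gamma>" and ab: "0 < a" "b < L"
    and fin: "finite (self_intersection_points L \<gamma>)"
    and trans: "\<forall>x\<in>self_intersection_points L \<gamma>. transverse_at L \<gamma> x"
    and h: "continuous_on UNIV h"
  shows "(\<integral>x. indicator (\<gamma> ` {a..b}) x *\<^sub>R h x \<partial>arc_length_measure L \<gamma>) =
    (1 / L) *\<^sub>R integral {a..b} (\<lambda>t. h (\<gamma> t))"
proof -
  let ?N = "{t \<in> {0..L}. \<gamma> t \<in> \<gamma> ` {a..b} \<and> t \<notin> {a..b}}"
  have cont: "continuous_on {0..L} \<gamma>" by (rule smooth_closed_curve_continuous_on[OF \<gamma>])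
  then have cont_ab: "continuous_on {a..b} \<gamma>" by (rule continuous_on_subset) (use ab in auto)
  then have "compact (\<gamma> ` {a..b})" by (rule compact_continuous_image) simp
  then have [measurable]: "\<gamma> ` {a..b} \<in> sets borel" by (rule borel_compact)
  have [measurable]: "h \<in> borel_measurable borel" using h by (rule borel_measurable_continuous_onI)
  have meas: "(\<lambda>x. indicator (\<gamma> ` {a..b}) x *\<^sub>R h x) \<in> borel_measurable borel" by measurable
  have hc: "continuous_on {a..b} (\<lambda>t. h (\<gamma> t))"
    using continuous_on_compose2[OF h cont_ab] by auto
  have int: "set_integrable lborel {a..b} (\<lambda>t. h (\<gamma> t))"
    unfolding set_integrable_def by (rule borel_integrable_compact[OF _ hc]) simp
  have "(LINT t:{0..L}|lborel. indicator (\<gamma> ` {a..b}) (\<gamma> t) *\<^sub>R h (\<gamma> t)) =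
      (LINT t:{a..b}|lborel. h (\<gamma> t))"
    unfolding set_lebesgue_integral_def
  proof (rule integral_cong_AE)
    have "(\<lambda>t. indicator (\<gamma> ` {a..b}) (\<gamma> t) *\<^sub>R h (\<gamma> t)) \<in> borel_measurable (restrict_space lborel {0..L})"
      using measurable_compose[OF measurable_restrict_lborel[OF cont] meas] .
    then show "(\<lambda>t. indicator {0..L} t *\<^sub>R indicator (\<gamma> ` {a..b}) (\<gamma> t) *\<^sub>R h (\<gamma> t)) \<in> borel_measurable lborel"
      by (subst (asm) borel_measurable_restrict_space_iff) auto
    show "(\<lambda>t. indicator {a..b} t *\<^sub>R h (\<gamma> t)) \<in> borel_measurable lborel"
      using int unfolding set_integrable_def by (rule borel_measurable_integrable)
    have "?N \<in> null_sets lborel"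
      by (intro finite_imp_null_set_lborel finite_arc_overlap[OF ab fin trans])
    then show "AE t in lborel. indicator {0..L} t *\<^sub>R indicator (\<gamma> ` {a..b}) (\<gamma> t) *\<^sub>R h (\<gamma> t) =
        indicator {a..b} t *\<^sub>R h (\<gamma> t)"
      by (rule AE_I') (use ab in \<open>auto simp: indicator_def\<close>)
  qed
  then show ?thesis
    using integral_arc_length_measure_borel[OF \<gamma> meas] set_borel_integral_eq_integral(2)[OF int]
    by simp
qed

text \<open>
  The test functions are the characters with frequency \<open>\<xi>\<close> cut off to an arc. The constant \<open>A\<close> here
  is \<open>L\<close> times the frame constant, since \<open>\<mu>\<close> is normalized.
\<close>

lemma tight_frame_arc_transform:
  assumes \<gamma>: "smooth_closed_curve L \<gamma>"
    and fin: "finite (self_intersection_points L \<gamma>)"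
    and trans: "\<forall>x\<in>self_intersection_points L \<gamma>. transverse_at L \<gamma> x"
    and frame: "tight_frame_spectral (arc_length_measure L \<gamma>)"
  obtains \<Lambda> A where "0 < A"
    and "\<And>a b \<xi>. 0 < a \<Longrightarrow> a < b \<Longrightarrow> b < L \<Longrightarrow>
      ((\<lambda>l. (cmod (arc_transform \<gamma> a b (l - \<xi>)))\<^sup>2) has_sum (A * (b - a))) \<Lambda>"
proof -
  have L: "0 < L" using \<gamma> by (simp add: smooth_closed_curve_def)
  let ?\<mu> = "arc_length_measure L \<gamma>"
  obtain \<Lambda> A where A: "0 < A" and tight: "\<And>f :: real^2 \<Rightarrow> complex.
      f \<in> borel_measurable ?\<mu> \<Longrightarrow> integrable ?\<mu> (\<lambda>x. (cmod (f x))\<^sup>2) \<Longrightarrow>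
      ((\<lambda>l. (cmod (\<integral>x. f x * exp (- 2 * of_real pi * \<i> * of_real (l \<bullet> x)) \<partial>?\<mu>))\<^sup>2)
             has_sum (A * (\<integral>x. (cmod (f x))\<^sup>2 \<partial>?\<mu>))) \<Lambda>"
    using frame unfolding tight_frame_spectral_def by blast
  interpret prob_space ?\<mu> by (rule prob_space_arc_length_measure[OF \<gamma>])
  have "((\<lambda>l. (cmod (arc_transform \<gamma> a b (l - \<xi>)))\<^sup>2) has_sum (A * L * (b - a))) \<Lambda>"
    if ab: "0 < a" "a < b" "b < L" for a b \<xi>
  proof -
    define f where "f x = indicator (\<gamma> ` {a..b}) x *\<^sub>R cis (2 * pi * (\<xi> \<bullet> x))" for x
    have cont_ab: "continuous_on {a..b} \<gamma>"
      using smooth_closed_curve_continuous_on[OF \<gamma>] by (rule continuous_on_subset) (use ab in auto)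
    then have "compact (\<gamma> ` {a..b})" by (rule compact_continuous_image) simp
    then have [measurable]: "\<gamma> ` {a..b} \<in> sets borel" by (rule borel_compact)
    have [measurable]: "(\<lambda>x. cis (2 * pi * (\<xi> \<bullet> x))) \<in> borel_measurable borel"
      by (intro borel_measurable_continuous_onI continuous_intros)
    have fm: "f \<in> borel_measurable borel" unfolding f_def by measurable
    then have fm': "f \<in> borel_measurable ?\<mu>" by (simp cong: measurable_cong_sets)
    have sq: "(cmod (f x))\<^sup>2 = indicator (\<gamma> ` {a..b}) x *\<^sub>R 1" for x
      by (simp add: f_def indicator_def)
    have "(\<lambda>x. (cmod (f x))\<^sup>2) \<in> borel_measurable ?\<mu>" using fm' by measurable
    then have int: "integrable ?\<mu> (\<lambda>x. (cmod (f x))\<^sup>2)"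
      by (intro integrable_const_bound[where B=1]) (auto simp: sq indicator_def)
    have "(\<integral>x. (cmod (f x))\<^sup>2 \<partial>?\<mu>) = (1 / L) *\<^sub>R integral {a..b} (\<lambda>t. 1::real)"
      unfolding sq using integral_arc[OF \<gamma> ab(1,3) fin trans, of "\<lambda>_. 1::real"] by simp
    then have nrm: "(\<integral>x. (cmod (f x))\<^sup>2 \<partial>?\<mu>) = (b - a) / L" using ab by simp
    have coeff: "(\<integral>x. f x * exp (- 2 * of_real pi * \<i> * of_real (l \<bullet> x)) \<partial>?\<mu>) =
        (1 / L) *\<^sub>R arc_transform \<gamma> a b (l - \<xi>)" for l
    proof -
      have "f x * exp (- 2 * of_real pi * \<i> * of_real (l \<bullet> x)) =
          indicator (\<gamma> ` {a..b}) x *\<^sub>R cis (- (2 * pi) * ((l - \<xi>) \<bullet> x))" for x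
      proof -
        have "exp (- 2 * of_real pi * \<i> * of_real (l \<bullet> x)) = cis (- (2 * pi) * (l \<bullet> x))"
          by (simp add: cis_conv_exp mult_ac)
        then show ?thesis
          by (simp add: f_def cis_mult inner_diff_left algebra_simps)
      qed
      then show ?thesis
        unfolding arc_transform_def
        using integral_arc[OF \<gamma> ab(1,3) fin trans, of "\<lambda>x. cis (- (2 * pi) * ((l - \<xi>) \<bullet> x))"]
        by (simp add: continuous_intros)
    qed
    have "((\<lambda>l. (cmod ((1 / L) *\<^sub>R arc_transform \<gamma> a b (l - \<xi>)))\<^sup>2) has_sum (A * ((b - a) / L))) \<Lambda>"
      using tight[OF fm' int] unfolding coeff nrm .
    then have "((\<lambda>l. L\<^sup>2 * (cmod ((1 / L) *\<^sub>R arc_transform \<gamma> a b (l - \<xi>)))\<^sup>2) has_sum (L\<^sup>2 * (A * ((b - a) / L)))) \<Lambda>"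
      by (rule has_sum_cmult_right)
    moreover have "L\<^sup>2 * (cmod ((1 / L) *\<^sub>R z))\<^sup>2 = (cmod z)\<^sup>2" for z
      using L by (simp add: power_mult_distrib power_divide)
    moreover have "L\<^sup>2 * (A * ((b - a) / L)) = A * L * (b - a)"
      using L by (simp add: power2_eq_square)
    ultimately show ?thesis by simp
  qed
  moreover have "0 < A * L" using A L by simp
  ultimately show ?thesis using that by blast
qed

section \<open>The Fourier transform of a curved arc\<close>

text \<open>
  Only the open interval of parameters is used for derivatives, so that they are two-sided; arcs will
  stay away from the base point \<open>\<gamma> 0 = \<gamma> L\<close>.
\<close>

locale curved_loop =
  fixes \<gamma> \<gamma>' \<gamma>'' :: "real \<Rightarrow> real^2" and L :: real
  assumes L_pos: "0 < L"
    and continuous: "continuous_on {0..L} \<gamma>"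
    and closed: "\<gamma> 0 = \<gamma> L"
    and deriv: "\<And>t. t \<in> {0<..<L} \<Longrightarrow> (\<gamma> has_vector_derivative \<gamma>' t) (at t)"
    and deriv2: "\<And>t. t \<in> {0<..<L} \<Longrightarrow> (\<gamma>' has_vector_derivative \<gamma>'' t) (at t)"
    and cont2: "continuous_on {0<..<L} \<gamma>''"
    and unit_speed: "\<And>t. t \<in> {0<..<L} \<Longrightarrow> norm (\<gamma>' t) = 1"
    and curved: "\<And>t. t \<in> {0<..<L} \<Longrightarrow> \<gamma>'' t \<noteq> 0"
begin

lemma deriv_inner:
  assumes "t \<in> {0<..<L}"
  shows "((\<lambda>t. c * (x \<bullet> \<gamma> t)) has_real_derivative c * (x \<bullet> \<gamma>' t)) (at t)"
    and "((\<lambda>t. c * (x \<bullet> \<gamma>' t)) has_real_derivative c * (x \<bullet> \<gamma>'' t)) (at t)"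
proof -
  have "((\<lambda>t. x \<bullet> \<gamma> t) has_real_derivative x \<bullet> \<gamma>' t) (at t)"
    "((\<lambda>t. x \<bullet> \<gamma>' t) has_real_derivative x \<bullet> \<gamma>'' t) (at t)"
    unfolding has_real_derivative_iff_has_vector_derivative
    using bounded_linear.has_vector_derivative[OF bounded_linear_inner_right] deriv[OF assms] deriv2[OF assms]
    by blast+
  then show "((\<lambda>t. c * (x \<bullet> \<gamma> t)) has_real_derivative c * (x \<bullet> \<gamma>' t)) (at t)"
    and "((\<lambda>t. c * (x \<bullet> \<gamma>' t)) has_real_derivative c * (x \<bullet> \<gamma>'' t)) (at t)"
    by - (rule DERIV_cmult, assumption)+
qed

lemma velocity_orthogonal_acceleration:
  assumes t: "t \<in> {0<..<L}"
  shows "\<gamma>' t \<bullet> \<gamma>'' t = 0"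
proof -
  have "((\<lambda>s. \<gamma>' s \<bullet> \<gamma>' s) has_real_derivative (\<gamma>' t \<bullet> \<gamma>'' t + \<gamma>'' t \<bullet> \<gamma>' t)) (at t)"
    unfolding has_real_derivative_iff_has_vector_derivative
    using bounded_bilinear.has_vector_derivative[OF bounded_bilinear_inner deriv2[OF t] deriv2[OF t]] .
  then have "\<gamma>' t \<bullet> \<gamma>'' t + \<gamma>'' t \<bullet> \<gamma>' t = 0"
  proof (rule DERIV_local_const)
    show "0 < min t (L - t)" using t by simp
    show "\<forall>s. \<bar>t - s\<bar> < min t (L - t) \<longrightarrow> \<gamma>' t \<bullet> \<gamma>' t = \<gamma>' s \<bullet> \<gamma>' s"
    proof (intro allI impI)
      fix s assume "\<bar>t - s\<bar> < min t (L - t)"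
      then have "s \<in> {0<..<L}" by auto
      then show "\<gamma>' t \<bullet> \<gamma>' t = \<gamma>' s \<bullet> \<gamma>' s" using unit_speed t by (simp add: dot_square_norm)
    qed
  qed
  then show ?thesis by (simp add: inner_commute)
qed

text \<open>
  Pythagoras in the orthogonal frame of velocity and acceleration, with denominators cleared.
\<close>

lemma frame_decomposition:
  assumes t: "t \<in> {0<..<L}"
  shows "(x \<bullet> \<gamma>' t)\<^sup>2 * (norm (\<gamma>'' t))\<^sup>2 + (x \<bullet> \<gamma>'' t)\<^sup>2 = (norm x)\<^sup>2 * (norm (\<gamma>'' t))\<^sup>2"
proof -
  obtain p q where u: "\<gamma>' t $ 1 = p" "\<gamma>' t $ 2 = q" by blast
  obtain y z where x: "x $ 1 = y" "x $ 2 = z" by blast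
  define k where "k = p * \<gamma>'' t $ 2 - q * \<gamma>'' t $ 1"
  have one: "p * p + q * q = 1"
    using unit_speed[OF t] by (simp add: norm_eq_1 inner_vec_def sum_2 u)
  have orth: "p * \<gamma>'' t $ 1 + q * \<gamma>'' t $ 2 = 0"
    using velocity_orthogonal_acceleration[OF t] by (simp add: inner_vec_def sum_2 u)
  have "\<gamma>'' t $ 1 = (p * p + q * q) * \<gamma>'' t $ 1" using one by simp
  also have "\<dots> = p * (p * \<gamma>'' t $ 1 + q * \<gamma>'' t $ 2) - q * k" by (simp add: k_def algebra_simps)
  finally have v1: "\<gamma>'' t $ 1 = - q * k" using orth by simp
  have "\<gamma>'' t $ 2 = (p * p + q * q) * \<gamma>'' t $ 2" using one by simp
  also have "\<dots> = q * (p * \<gamma>'' t $ 1 + q * \<gamma>'' t $ 2) + p * k" by (simp add: k_def algebra_simps)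
  finally have v2: "\<gamma>'' t $ 2 = p * k" using orth by simp
  have "(norm (\<gamma>'' t))\<^sup>2 = (p * p + q * q) * (k * k)"
    by (simp add: power2_norm_eq_inner inner_vec_def sum_2 v1 v2 algebra_simps)
  then have nv: "(norm (\<gamma>'' t))\<^sup>2 = k * k" using one by simp
  have nx: "(norm x)\<^sup>2 = y * y + z * z"
    by (simp add: power2_norm_eq_inner inner_vec_def sum_2 x)
  have "(x \<bullet> \<gamma>' t)\<^sup>2 * (k * k) + (x \<bullet> \<gamma>'' t)\<^sup>2 = (y * y + z * z) * (p * p + q * q) * (k * k)"
    by (simp add: inner_vec_def sum_2 u x v1 v2 power2_eq_square algebra_simps)
  then show ?thesis using one by (simp add: nv nx)
qed

lemma arc_continuous:
  assumes "0 < a" "b < L"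
  shows "continuous_on {a..b} \<gamma>"
  using continuous by (rule continuous_on_subset) (use assms in auto)

lemma arc_transform_uminus:
  assumes "0 < a" "b < L"
  shows "cmod (arc_transform \<gamma> a b (- x)) = cmod (arc_transform \<gamma> a b x)"
proof -
  have "(\<lambda>t. cis (- (2 * pi) * (x \<bullet> \<gamma> t))) integrable_on {a..b}"
    by (intro integrable_continuous_interval continuous_intros arc_continuous assms)
  from integral_linear[OF this bounded_linear_cnj]
  have "arc_transform \<gamma> a b (- x) = cnj (arc_transform \<gamma> a b x)"
    by (simp add: arc_transform_def o_def cis_cnj)
  then show ?thesis by simp
qed

lemma arc_transform_le:
  assumes "0 < a" "a \<le> b" "b < L"
  shows "cmod (arc_transform \<gamma> a b x) \<le> b - a"
proof -
  have "norm (integral {a..b} (\<lambda>t. cis (- (2 * pi) * (x \<bullet> \<gamma> t)))) \<le> 1 * (b - a)"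
    by (rule integral_bound) (use assms in \<open>auto intro!: continuous_intros arc_continuous\<close>)
  then show ?thesis by (simp add: arc_transform_def)
qed

text \<open>
  Closedness enters here: \<open>e \<bullet> \<gamma>\<close> has equal values at the two ends, so Rolle's theorem provides a
  point whose tangent is orthogonal to \<open>e\<close>, away from the base point. There \<open>e\<close> is parallel to
  the acceleration, which is nonzero.
\<close>

lemma exists_critical_point:
  assumes e: "norm e = 1"
  obtains t where "t \<in> {0<..<L}" "e \<bullet> \<gamma>' t = 0" "e \<bullet> \<gamma>'' t \<noteq> 0"
proof -
  have "\<exists>t>0. t < L \<and> DERIV (\<lambda>t. e \<bullet> \<gamma> t) t :> 0"
  proof (rule Rolle)
    show "continuous_on {0..L} (\<lambda>t. e \<bullet> \<gamma> t)" by (intro continuous_intros continuous)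
    show "(\<lambda>t. e \<bullet> \<gamma> t) differentiable (at t)" if "0 < t" "t < L" for t
      using deriv_inner(1)[of t 1 e] that real_differentiable_def by auto
  qed (use L_pos closed in auto)
  then obtain t where t: "t \<in> {0<..<L}" and "DERIV (\<lambda>t. e \<bullet> \<gamma> t) t :> 0" by auto
  then have crit: "e \<bullet> \<gamma>' t = 0"
    using deriv_inner(1)[OF t, of 1 e] DERIV_unique by fastforce
  then have "(e \<bullet> \<gamma>'' t)\<^sup>2 = (norm (\<gamma>'' t))\<^sup>2"
    using frame_decomposition[OF t, of e] e by simp
  then have "e \<bullet> \<gamma>'' t \<noteq> 0" using curved[OF t] by auto
  then show ?thesis using that t crit by blast
qed

lemma arc_around:
  assumes t: "t \<in> {0<..<L}" and ev: "\<forall>\<^sub>F s in at t. P s" and P: "P t"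
  obtains \<epsilon> where "0 < \<epsilon>" "0 < t - \<epsilon>" "t + \<epsilon> < L" "\<And>s. s \<in> {t - \<epsilon>..t + \<epsilon>} \<Longrightarrow> P s"
proof -
  obtain d where d: "0 < d" "\<And>s. s \<noteq> t \<Longrightarrow> dist s t < d \<Longrightarrow> P s"
    using ev unfolding eventually_at by auto
  define \<epsilon> where "\<epsilon> = min (d / 2) (min (t / 2) ((L - t) / 2))"
  have \<epsilon>: "0 < \<epsilon>" "\<epsilon> < d" "\<epsilon> < t" "\<epsilon> < L - t"
    using d(1) t by (auto simp: \<epsilon>_def min_less_iff_disj)
  have "P s" if "s \<in> {t - \<epsilon>..t + \<epsilon>}" for s
  proof (cases "s = t")
    case False
    have "dist s t < d" using that \<epsilon> by (auto simp: dist_real_def)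
    then show ?thesis by (rule d(2)[OF False])
  qed (use P in simp)
  then show ?thesis using that[of \<epsilon>] \<epsilon> by auto
qed

lemma isCont_derivs:
  assumes t: "t \<in> {0<..<L}"
  shows "isCont \<gamma>' t" "isCont \<gamma>'' t"
  using has_vector_derivative_continuous[OF deriv2[OF t]] t cont2
  by (auto simp: continuous_on_eq_continuous_at)

lemma bounded_acceleration:
  assumes "0 < a" "b < L"
  obtains M where "0 < M" "\<And>t. t \<in> {a..b} \<Longrightarrow> norm (\<gamma>'' t) \<le> M"
proof -
  have "continuous_on {a..b} \<gamma>''" using cont2 by (rule continuous_on_subset) (use assms in auto)
  then have "compact (\<gamma>'' ` {a..b})" by (rule compact_continuous_image) simp
  then have "bounded (\<gamma>'' ` {a..b})" by (rule compact_imp_bounded)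
  then obtain M where "0 < M" "\<forall>v\<in>\<gamma>'' ` {a..b}. norm v \<le> M" unfolding bounded_pos by blast
  then show ?thesis using that by blast
qed

text \<open>
  Around the stationary point of \<open>e \<bullet> \<gamma>\<close> all nearby directions \<open>d\<close> still have \<open>d \<bullet> \<gamma>''\<close> bounded
  below, and \<open>d \<bullet> \<gamma>'\<close> still changes sign between the ends of the arc. So \<open>d \<bullet> \<gamma>\<close> has its
  own stationary point, at a fixed distance from both ends. For \<open>|x| \<ge> R\<close> this distance is at
  least the scale \<open>1 / sqrt K\<close> of the stationary phase bound.
\<close>

lemma arc_transform_ge_near_direction_aux:
  assumes e: "norm e = 1" and t0: "t0 \<in> {0<..<L}" and crit: "e \<bullet> \<gamma>' t0 = 0" and pos: "0 < e \<bullet> \<gamma>'' t0"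
  obtains a b c \<delta> R where "0 < a" "a < b" "b < L" "0 < c" "0 < \<delta>" "0 < R"
    "\<And>x. R \<le> norm x \<Longrightarrow> norm (x /\<^sub>R norm x - e) < \<delta> \<Longrightarrow>
       c * decay_weight x \<le> (cmod (arc_transform \<gamma> a b x))\<^sup>2"
proof -
  define q where "q = e \<bullet> \<gamma>'' t0"
  have q: "0 < q" using pos by (simp add: q_def)
  have "isCont (\<lambda>t. e \<bullet> \<gamma>'' t) t0" by (intro continuous_intros isCont_derivs t0)
  then have "\<forall>\<^sub>F t in at t0. q / 2 < e \<bullet> \<gamma>'' t"
    using q unfolding isCont_def by (intro order_tendstoD(1)) (auto simp: q_def)
  then obtain \<epsilon> where \<epsilon>: "0 < \<epsilon>" "0 < t0 - \<epsilon>" "t0 + \<epsilon> < L"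
    and conv: "\<And>t. t \<in> {t0 - \<epsilon>..t0 + \<epsilon>} \<Longrightarrow> q / 2 < e \<bullet> \<gamma>'' t"
    using q by (auto simp: q_def elim: arc_around[OF t0])
  define a b where "a = t0 - \<epsilon>" and "b = t0 + \<epsilon>"
  have ab: "0 < a" "a < t0" "t0 < b" "b < L" using \<epsilon> by (auto simp: a_def b_def)
  have inL: "t \<in> {0<..<L}" if "t \<in> {a..b}" for t using that ab by auto
  obtain M where M: "0 < M" "\<And>t. t \<in> {a..b} \<Longrightarrow> norm (\<gamma>'' t) \<le> M"
    using bounded_acceleration ab by metis
  define \<eta> where "\<eta> = q / 2 * \<epsilon>"
  have \<eta>: "0 < \<eta>" using q \<epsilon> by (simp add: \<eta>_def)
  have growth: "q / 2 * (t - s) \<le> e \<bullet> \<gamma>' t - e \<bullet> \<gamma>' s" if "s \<in> {a..b}" "t \<in> {a..b}" "s \<le> t" for s t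
  proof (rule deriv_ge_imp_growth[OF that(3)])
    fix z assume z: "z \<in> {s..t}"
    then have zab: "z \<in> {a..b}" using that by auto
    show "((\<lambda>t. e \<bullet> \<gamma>' t) has_real_derivative e \<bullet> \<gamma>'' z) (at z)"
      using deriv_inner(2)[OF inL[OF zab], of 1 e] by simp
    show "q / 2 \<le> e \<bullet> \<gamma>'' z" using conv[of z] zab by (simp add: a_def b_def)
  qed
  have eb: "\<eta> \<le> e \<bullet> \<gamma>' b"
    using growth[of t0 b] ab crit by (simp add: \<eta>_def b_def)
  have ea: "e \<bullet> \<gamma>' a \<le> - \<eta>"
    using growth[of a t0] ab crit by (simp add: \<eta>_def a_def)
  define \<delta> where "\<delta> = min (q / (4 * M)) (\<eta> / 2)"
  have \<delta>: "0 < \<delta>" "\<delta> * M \<le> q / 4" "\<delta> \<le> \<eta> / 2"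
    using q M \<eta> by (auto simp: \<delta>_def min_def field_simps)
  \<comment> \<open>A stationary point stays at distance \<open>\<eta> / (2 M)\<close> from the ends; beyond \<open>R\<close> this is at least
    \<open>1 / sqrt K\<close> for \<open>K = 2 \<pi> |x| M\<close>.\<close>
  define R where "R = max 1 ((2 * M / \<eta>)\<^sup>2 / (2 * pi * M))"
  define c where "c = ((q / (4 * M)) ^ 3 / 24)\<^sup>2 / (2 * pi * M)"
  have c: "0 < c" using q M by (simp add: c_def)
  have "c * decay_weight x \<le> (cmod (arc_transform \<gamma> a b x))\<^sup>2"
    if x: "R \<le> norm x" "norm (x /\<^sub>R norm x - e) < \<delta>" for x
  proof -
    define r where "r = norm x"
    define d where "d = x /\<^sub>R r"
    have r: "1 \<le> r" "(2 * M / \<eta>)\<^sup>2 / (2 * pi * M) \<le> r" using x by (auto simp: r_def R_def)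
    have xd: "x = r *\<^sub>R d" using r by (simp add: d_def)
    have "0 < norm x" using r(1) unfolding r_def by linarith
    then have nd: "norm d = 1" by (simp add: d_def r_def)
    have close: "\<bar>d \<bullet> v - e \<bullet> v\<bar> \<le> \<delta> * norm v" for v
    proof -
      have "\<bar>(d - e) \<bullet> v\<bar> \<le> norm (d - e) * norm v" by (rule Cauchy_Schwarz_ineq2)
      also have "\<dots> \<le> \<delta> * norm v"
        using x by (intro mult_right_mono) (auto simp: d_def r_def)
      finally show ?thesis by (simp add: inner_diff_left)
    qed
    have lo: "q / 4 \<le> d \<bullet> \<gamma>'' t" if t: "t \<in> {a..b}" for t
    proof -
      have "\<delta> * norm (\<gamma>'' t) \<le> \<delta> * M" using M(2)[OF t] \<delta> by (intro mult_left_mono) auto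
      moreover have "q / 2 < e \<bullet> \<gamma>'' t" using conv[of t] t by (simp add: a_def b_def)
      ultimately show ?thesis using close[of "\<gamma>'' t"] \<delta>(2) by linarith
    qed
    have hi: "d \<bullet> \<gamma>'' t \<le> M" if t: "t \<in> {a..b}" for t
      using Cauchy_Schwarz_ineq2[of d "\<gamma>'' t"] M(2)[OF t] nd by simp
    have db: "\<eta> / 2 \<le> d \<bullet> \<gamma>' b"
      using close[of "\<gamma>' b"] eb \<delta> unit_speed[OF inL, of b] ab by simp
    have da: "d \<bullet> \<gamma>' a \<le> - \<eta> / 2"
      using close[of "\<gamma>' a"] ea \<delta> unit_speed[OF inL, of a] ab by simp
    have dd: "((\<lambda>t. d \<bullet> \<gamma>' t) has_real_derivative d \<bullet> \<gamma>'' t) (at t)" if "t \<in> {a..b}" for t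
      using deriv_inner(2)[of t 1 d] inL that by simp
    have "continuous_on {a..b} (\<lambda>t. d \<bullet> \<gamma>' t)"
      by (rule DERIV_atLeastAtMost_imp_continuous_on) (use dd in auto)
    then obtain z where z: "z \<in> {a..b}" "d \<bullet> \<gamma>' z = 0"
      using IVT'[of "\<lambda>t. d \<bullet> \<gamma>' t" a 0 b] da db \<eta> ab by auto
    have "- M * (b - z) \<le> - (d \<bullet> \<gamma>' b) - - (d \<bullet> \<gamma>' z)"
      by (rule deriv_ge_imp_growth[of z b "\<lambda>t. - (d \<bullet> \<gamma>' t)" "\<lambda>t. - (d \<bullet> \<gamma>'' t)"])
        (use z dd hi in \<open>auto intro!: DERIV_minus\<close>)
    then have zb: "\<eta> / (2 * M) \<le> b - z" using db z M by (simp add: field_simps)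
    have "- M * (z - a) \<le> - (d \<bullet> \<gamma>' z) - - (d \<bullet> \<gamma>' a)"
      by (rule deriv_ge_imp_growth[of a z "\<lambda>t. - (d \<bullet> \<gamma>' t)" "\<lambda>t. - (d \<bullet> \<gamma>'' t)"])
        (use z dd hi in \<open>auto intro!: DERIV_minus\<close>)
    then have za: "\<eta> / (2 * M) \<le> z - a" using da z M by (simp add: field_simps)
    define K where "K = 2 * pi * r * M"
    have K: "0 < K" using r M by (simp add: K_def)
    have "0 < 2 * pi * M" using M by simp
    then have "(2 * M / \<eta>)\<^sup>2 \<le> r * (2 * pi * M)" using r(2) by (simp only: pos_divide_le_eq)
    then have "(2 * M / \<eta>)\<^sup>2 \<le> K" by (simp only: K_def mult_ac)
    then have "2 * M / \<eta> \<le> sqrt K" by (rule real_le_rsqrt)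
    then have "1 / sqrt K \<le> 1 / (2 * M / \<eta>)"
      using M \<eta> K by (intro divide_left_mono) auto
    then have step: "1 / sqrt K \<le> \<eta> / (2 * M)" by simp
    define m where "m = 2 * pi * r * (q / 4)"
    have m: "0 < m" using r q by (simp add: m_def)
    have "(m / K) ^ 3 / (24 * sqrt K) \<le> cmod (integral {a..b} (\<lambda>t. cis (2 * pi * (x \<bullet> \<gamma> t))))"
    proof (rule integral_cis_stationary_ge[OF m K, where c=z and \<psi>'="\<lambda>t. 2 * pi * (x \<bullet> \<gamma>' t)" and \<psi>''="\<lambda>t. 2 * pi * (x \<bullet> \<gamma>'' t)"])
      show "a + 1 / sqrt K \<le> z" "z + 1 / sqrt K \<le> b" using za zb step by auto
      show "2 * pi * (x \<bullet> \<gamma>' z) = 0" using z xd by simp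
      fix t assume t: "t \<in> {a..b}"
      show "((\<lambda>t. 2 * pi * (x \<bullet> \<gamma> t)) has_real_derivative 2 * pi * (x \<bullet> \<gamma>' t)) (at t)"
        "((\<lambda>t. 2 * pi * (x \<bullet> \<gamma>' t)) has_real_derivative 2 * pi * (x \<bullet> \<gamma>'' t)) (at t)"
        by (intro deriv_inner inL t)+
      have rw: "2 * pi * (x \<bullet> \<gamma>'' t) = 2 * pi * r * (d \<bullet> \<gamma>'' t)" by (subst xd) simp
      show "m \<le> 2 * pi * (x \<bullet> \<gamma>'' t)" "2 * pi * (x \<bullet> \<gamma>'' t) \<le> K"
        unfolding rw m_def K_def using lo[OF t] hi[OF t] r by (intro mult_left_mono; simp)+
    qed
    also have "\<dots> = cmod (arc_transform \<gamma> a b (- x))" by (simp add: arc_transform_def)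
    also have "\<dots> = cmod (arc_transform \<gamma> a b x)" using ab by (intro arc_transform_uminus) auto
    finally have "((m / K) ^ 3 / (24 * sqrt K))\<^sup>2 \<le> (cmod (arc_transform \<gamma> a b x))\<^sup>2"
      using m K by (intro power_mono) auto
    moreover have "((m / K) ^ 3 / (24 * sqrt K))\<^sup>2 = c * decay_weight x"
    proof -
      have "m / K = q / (4 * M)" using r by (simp add: m_def K_def)
      then have "((m / K) ^ 3 / (24 * sqrt K))\<^sup>2 = ((q / (4 * M)) ^ 3 / 24)\<^sup>2 / K"
        using K by (simp add: power_divide power_mult_distrib)
      also have "\<dots> = c * (1 / r)" by (simp add: c_def K_def)
      also have "1 / r = decay_weight x" using r by (simp add: decay_weight_def r_def max_def)
      finally show ?thesis .
    qed
    ultimately show ?thesis by simp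
  qed
  moreover have "0 < R" by (simp add: R_def)
  ultimately show ?thesis using that[of a b c \<delta> R] ab c \<delta> by auto
qed

text \<open>
  If \<open>e\<close> points against the acceleration, the bound for \<open>- e\<close> carries over, since \<open>E(- x)\<close> is the
  conjugate of \<open>E(x)\<close>.
\<close>

lemma arc_transform_ge_near_direction:
  assumes e: "norm e = 1"
  obtains a b c \<delta> R where "0 < a" "a < b" "b < L" "0 < c" "0 < \<delta>" "0 < R"
    "\<And>x. R \<le> norm x \<Longrightarrow> norm (x /\<^sub>R norm x - e) < \<delta> \<Longrightarrow>
       c * decay_weight x \<le> (cmod (arc_transform \<gamma> a b x))\<^sup>2"
proof -
  obtain t where t: "t \<in> {0<..<L}" "e \<bullet> \<gamma>' t = 0" "e \<bullet> \<gamma>'' t \<noteq> 0"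
    using exists_critical_point[OF e] .
  show ?thesis
  proof (cases "0 < e \<bullet> \<gamma>'' t")
    case True
    then show ?thesis using arc_transform_ge_near_direction_aux[OF e t(1,2)] that by metis
  next
    case False
    then have "0 < (- e) \<bullet> \<gamma>'' t" "(- e) \<bullet> \<gamma>' t = 0" using t by auto
    then obtain a b c \<delta> R where *: "0 < a" "a < b" "b < L" "0 < c" "0 < \<delta>" "0 < R"
      "\<And>x. R \<le> norm x \<Longrightarrow> norm (x /\<^sub>R norm x - (- e)) < \<delta> \<Longrightarrow>
         c * decay_weight x \<le> (cmod (arc_transform \<gamma> a b x))\<^sup>2"
      using arc_transform_ge_near_direction_aux[of "- e" t] e t(1) by (metis norm_minus_cancel)
    have "c * decay_weight x \<le> (cmod (arc_transform \<gamma> a b x))\<^sup>2"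
      if "R \<le> norm x" "norm (x /\<^sub>R norm x - e) < \<delta>" for x
    proof -
      have "norm ((- x) /\<^sub>R norm (- x) - (- e)) = norm (x /\<^sub>R norm x - e)"
        using norm_minus_commute[of "x /\<^sub>R norm x" e] by simp
      then have "c * decay_weight (- x) \<le> (cmod (arc_transform \<gamma> a b (- x)))\<^sup>2"
        using that by (intro *(7)) auto
      then show ?thesis using arc_transform_uminus[OF *(1,3)] by (simp add: decay_weight_def)
    qed
    then show ?thesis using that * by blast
  qed
qed

text \<open>
  On an arc short compared with \<open>1 / R\<close>, the phases of all frequencies up to \<open>R\<close> are nearly
  constant, so nothing cancels. This serves to make \<open>\<Lambda>\<close> locally finite.
\<close>

lemma arc_transform_ge_near_origin:
  obtains a b c where "0 < a" "a < b" "b < L" "0 < c"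
    "\<And>x. norm x \<le> R \<Longrightarrow> c * decay_weight x \<le> (cmod (arc_transform \<gamma> a b x))\<^sup>2"
proof -
  define a where "a = L / 2"
  have a: "a \<in> {0<..<L}" using L_pos by (simp add: a_def)
  define \<rho> where "\<rho> = 1 / (4 * pi * (\<bar>R\<bar> + 1))"
  have \<rho>: "0 < \<rho>" by (simp add: \<rho>_def)
  have "isCont \<gamma> a" using has_vector_derivative_continuous[OF deriv[OF a]] .
  then have "\<forall>\<^sub>F t in at a. dist (\<gamma> t) (\<gamma> a) < \<rho>"
    unfolding isCont_def by (rule tendstoD[OF _ \<rho>])
  then obtain \<epsilon> where \<epsilon>: "0 < \<epsilon>" "a + \<epsilon> < L" "\<And>t. t \<in> {a - \<epsilon>..a + \<epsilon>} \<Longrightarrow> dist (\<gamma> t) (\<gamma> a) < \<rho>"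
    using \<rho> by (auto elim: arc_around[OF a])
  define b where "b = a + \<epsilon>"
  have ab: "0 < a" "a < b" "b < L" using a \<epsilon> by (auto simp: b_def)
  have "((b - a) / 2)\<^sup>2 * decay_weight x \<le> (cmod (arc_transform \<gamma> a b x))\<^sup>2" if x: "norm x \<le> R" for x
  proof -
    define g where "g t = cis (- (2 * pi) * (x \<bullet> (\<gamma> t - \<gamma> a)))" for t
    have gc: "continuous_on {a..b} g"
      unfolding g_def using ab by (intro continuous_intros arc_continuous) auto
    have near: "norm (g t - 1) \<le> 1 / 2" if t: "t \<in> {a..b}" for t
    proof -
      have "norm (g t - 1) \<le> \<bar>- (2 * pi) * (x \<bullet> (\<gamma> t - \<gamma> a))\<bar>"
        unfolding g_def by (rule norm_cis_minus_one_le)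
      also have "\<dots> = 2 * pi * \<bar>x \<bullet> (\<gamma> t - \<gamma> a)\<bar>" by (simp add: abs_mult)
      also have "\<dots> \<le> 2 * pi * (norm x * norm (\<gamma> t - \<gamma> a))"
        by (intro mult_left_mono Cauchy_Schwarz_ineq2) auto
      also have "\<dots> \<le> 2 * pi * ((\<bar>R\<bar> + 1) * \<rho>)"
        using x \<epsilon>(3)[of t] t ab by (intro mult_left_mono mult_mono) (auto simp: b_def dist_norm)
      also have "\<dots> = 1 / 2"
      proof -
        have "2 * pi * (s * (1 / (4 * pi * s))) = 1 / 2" if "0 < s" for s :: real using that by simp
        then show ?thesis unfolding \<rho>_def by simp
      qed
      finally show ?thesis .
    qed
    have "norm (integral {a..b} (\<lambda>t. g t - 1)) \<le> 1 / 2 * (b - a)"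
      by (rule integral_bound) (use ab near gc in \<open>auto intro!: continuous_intros\<close>)
    moreover have "integral {a..b} (\<lambda>t. g t - 1) = integral {a..b} g - of_real (b - a)"
      using ab by (subst Henstock_Kurzweil_Integration.integral_diff)
        (auto intro: integrable_continuous_interval gc simp: scaleR_conv_of_real)
    ultimately have "b - a - cmod (integral {a..b} g) \<le> (b - a) / 2"
      using norm_triangle_ineq2[of "of_real (b - a)" "integral {a..b} g"] ab
      by (simp add: norm_minus_commute flip: of_real_diff)
    moreover have "g = (\<lambda>t. cis (2 * pi * (x \<bullet> \<gamma> a)) * cis (- (2 * pi) * (x \<bullet> \<gamma> t)))"
      by (rule ext) (simp add: g_def cis_mult inner_diff_right algebra_simps)
    then have "cmod (integral {a..b} g) = cmod (arc_transform \<gamma> a b x)"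
      by (simp add: arc_transform_def norm_mult)
    ultimately have "(b - a) / 2 \<le> cmod (arc_transform \<gamma> a b x)" by simp
    then have "((b - a) / 2)\<^sup>2 \<le> (cmod (arc_transform \<gamma> a b x))\<^sup>2"
      using ab by (intro power_mono) auto
    moreover have "((b - a) / 2)\<^sup>2 * decay_weight x \<le> ((b - a) / 2)\<^sup>2 * 1"
      by (intro mult_left_mono) (auto simp: decay_weight_def)
    ultimately show ?thesis by simp
  qed
  then show ?thesis using that[of a b "((b - a) / 2)\<^sup>2"] ab by auto
qed


text \<open>
  On a short arc velocity and acceleration are almost constant, and a frequency \<open>x\<close> cannot be almost
  orthogonal to both. If it has a component along the velocity, the phase has no stationary point and
  integration by parts gives decay \<open>1 / |x|\<close>, better than required. Otherwise it has a component along
  the acceleration, and van der Corput's lemma gives the decay \<open>1 / sqrt |x|\<close>.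
\<close>

lemma arc_transform_upper:
  obtains a b C where "0 < a" "a < b" "b < L" "0 < C"
    "\<And>x. (cmod (arc_transform \<gamma> a b x))\<^sup>2 \<le> C * decay_weight x"
proof -
  define t0 where "t0 = L / 2"
  have t0: "t0 \<in> {0<..<L}" using L_pos by (simp add: t0_def)
  define u v k where "u = \<gamma>' t0" and "v = \<gamma>'' t0" and "k = norm v"
  have k: "0 < k" using curved[OF t0] by (simp add: k_def v_def)
  have "\<forall>\<^sub>F t in at t0. dist (\<gamma>' t) u < 1 / 4" "\<forall>\<^sub>F t in at t0. dist (\<gamma>'' t) v < k / 4"
    using isCont_derivs[OF t0] k unfolding isCont_def u_def v_def by (intro tendstoD; simp)+
  then have "\<forall>\<^sub>F t in at t0. dist (\<gamma>' t) u < 1 / 4 \<and> dist (\<gamma>'' t) v < k / 4"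
    by (rule eventually_conj)
  then obtain \<epsilon> where \<epsilon>: "0 < \<epsilon>" "0 < t0 - \<epsilon>" "t0 + \<epsilon> < L"
    and near: "\<And>t. t \<in> {t0 - \<epsilon>..t0 + \<epsilon>} \<Longrightarrow> dist (\<gamma>' t) u < 1 / 4 \<and> dist (\<gamma>'' t) v < k / 4"
    using k by (auto simp: u_def v_def elim: arc_around[OF t0])
  define a b where "a = t0 - \<epsilon>" and "b = t0 + \<epsilon>"
  have ab: "0 < a" "a < b" "b < L" using \<epsilon> by (auto simp: a_def b_def)
  have inL: "t \<in> {0<..<L}" if "t \<in> {a..b}" for t using that ab by auto
  define C1 where "C1 = 4 / pi + 16 * k * (b - a) / pi"
  have C1: "0 < C1" using k ab by (simp add: C1_def add_pos_nonneg)
  define C where "C = (b - a)\<^sup>2 + C1\<^sup>2 + 72 / (pi * k)"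
  have C: "0 < C" "(b - a)\<^sup>2 \<le> C" "C1\<^sup>2 \<le> C" "72 / (pi * k) \<le> C"
    using k ab by (auto simp: C_def intro!: add_pos_nonneg add_nonneg_nonneg)
  have "(cmod (arc_transform \<gamma> a b x))\<^sup>2 \<le> C * decay_weight x" for x
  proof (cases "norm x \<le> 1")
    case True
    have "(cmod (arc_transform \<gamma> a b x))\<^sup>2 \<le> (b - a)\<^sup>2"
      using arc_transform_le[of a b x] ab by (intro power_mono) auto
    moreover have "decay_weight x = 1" using True by (simp add: decay_weight_def max_def)
    ultimately show ?thesis using C by simp
  next
    case False
    define r where "r = norm x"
    have r: "1 < r" using False by (simp add: r_def)
    have w: "decay_weight x = 1 / r" using r by (simp add: decay_weight_def r_def max_def)
    have close1: "\<bar>x \<bullet> \<gamma>' t - x \<bullet> u\<bar> \<le> r * (1 / 4)" if "t \<in> {a..b}" for t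
    proof -
      have "\<bar>x \<bullet> (\<gamma>' t - u)\<bar> \<le> r * norm (\<gamma>' t - u)" unfolding r_def by (rule Cauchy_Schwarz_ineq2)
      also have "\<dots> \<le> r * (1 / 4)"
        using near[of t] that r by (intro mult_left_mono) (auto simp: a_def b_def dist_norm)
      finally show ?thesis by (simp add: inner_diff_right)
    qed
    have close2: "\<bar>x \<bullet> \<gamma>'' t - x \<bullet> v\<bar> \<le> r * (k / 4)" if "t \<in> {a..b}" for t
    proof -
      have "\<bar>x \<bullet> (\<gamma>'' t - v)\<bar> \<le> r * norm (\<gamma>'' t - v)" unfolding r_def by (rule Cauchy_Schwarz_ineq2)
      also have "\<dots> \<le> r * (k / 4)"
        using near[of t] that r by (intro mult_left_mono) (auto simp: a_def b_def dist_norm)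
      finally show ?thesis by (simp add: inner_diff_right)
    qed
    show ?thesis
    proof (cases "r / 2 \<le> \<bar>x \<bullet> u\<bar>")
      case True
      have slope: "r / 4 \<le> \<bar>x \<bullet> \<gamma>' t\<bar>" if "t \<in> {a..b}" for t
        using close1[OF that] True by linarith
      have phase: "pi * r / 2 \<le> \<bar>- (2 * pi) * (x \<bullet> \<gamma>' t)\<bar>" if "t \<in> {a..b}" for t
        using mult_left_mono[OF slope[OF that], of "2 * pi"] by (simp add: abs_mult)
      have pr: "0 < pi * r / 2" using r by simp
      have bend: "\<bar>- (2 * pi) * (x \<bullet> \<gamma>'' t)\<bar> \<le> 4 * pi * r * k" if t: "t \<in> {a..b}" for t
      proof -
        have "\<bar>x \<bullet> v\<bar> \<le> r * k" unfolding r_def k_def by (rule Cauchy_Schwarz_ineq2)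
        then have "\<bar>x \<bullet> \<gamma>'' t\<bar> \<le> r * k + r * (k / 4)" using close2[OF t] by linarith
        also have "\<dots> \<le> 2 * (r * k)" using r k by simp
        finally have "2 * pi * \<bar>x \<bullet> \<gamma>'' t\<bar> \<le> 2 * pi * (2 * (r * k))"
          by (rule mult_left_mono) simp
        then show ?thesis by (simp add: abs_mult)
      qed
      define B where "B = 4 * pi * r * k / (pi * r / 2)\<^sup>2"
      have "cmod (integral {a..b} (\<lambda>t. cis (- (2 * pi) * (x \<bullet> \<gamma> t)))) \<le>
          1 / \<bar>- (2 * pi) * (x \<bullet> \<gamma>' a)\<bar> + 1 / \<bar>- (2 * pi) * (x \<bullet> \<gamma>' b)\<bar> + (B * b - B * a)"
      proof (rule integral_cis_deriv_bound[where \<phi>''="\<lambda>t. - (2 * pi) * (x \<bullet> \<gamma>'' t)" and g'="\<lambda>_. B"])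
        fix t assume t: "t \<in> {a..b}"
        show "((\<lambda>t. - (2 * pi) * (x \<bullet> \<gamma> t)) has_real_derivative - (2 * pi) * (x \<bullet> \<gamma>' t)) (at t)"
          "((\<lambda>t. - (2 * pi) * (x \<bullet> \<gamma>' t)) has_real_derivative - (2 * pi) * (x \<bullet> \<gamma>'' t)) (at t)"
          by (intro deriv_inner inL t)+
        show "- (2 * pi) * (x \<bullet> \<gamma>' t) \<noteq> 0" using phase[OF t] pr by linarith
        show "((\<lambda>t. B * t) has_real_derivative B) (at t)" by (auto intro!: derivative_eq_intros)
        have "(pi * r / 2)\<^sup>2 \<le> \<bar>- (2 * pi) * (x \<bullet> \<gamma>' t)\<bar>\<^sup>2"
          using phase[OF t] pr by (intro power_mono) auto
        then have den: "(pi * r / 2)\<^sup>2 \<le> (- (2 * pi) * (x \<bullet> \<gamma>' t))\<^sup>2" by (simp only: power2_abs)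
        have "0 < (pi * r / 2)\<^sup>2" by (rule zero_less_power[OF pr])
        moreover have "0 \<le> 4 * pi * r * k" using r k by simp
        ultimately show "\<bar>- (2 * pi) * (x \<bullet> \<gamma>'' t)\<bar> / (- (2 * pi) * (x \<bullet> \<gamma>' t))\<^sup>2 \<le> B"
          unfolding B_def using frac_le[OF _ bend[OF t] _ den] by blast
      qed (use ab in simp)
      also have "\<dots> \<le> 1 / (pi * r / 2) + 1 / (pi * r / 2) + B * (b - a)"
      proof -
        have "1 / \<bar>- (2 * pi) * (x \<bullet> \<gamma>' t)\<bar> \<le> 1 / (pi * r / 2)" if "t \<in> {a..b}" for t
          using frac_le[OF zero_le_one order_refl pr phase[OF that]] .
        from this[of a] this[of b] show ?thesis using ab by (simp only: right_diff_distrib) simp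
      qed
      also have "\<dots> = C1 / r"
      proof -
        have "1 / (pi * s / 2) + 1 / (pi * s / 2) + 4 * pi * s * k / (pi * s / 2)\<^sup>2 * h =
            (4 / pi + 16 * k * h / pi) / s" if "0 < s" for s h :: real
          using that by (simp add: field_simps power2_eq_square)
        from this[of r "b - a"] show ?thesis using r unfolding C1_def B_def by simp
      qed
      finally have "(cmod (arc_transform \<gamma> a b x))\<^sup>2 \<le> (C1 / r)\<^sup>2"
        unfolding arc_transform_def by (intro power_mono) auto
      also have "\<dots> = C1\<^sup>2 * (1 / r\<^sup>2)" by (simp add: power_divide)
      also have "\<dots> \<le> C * (1 / r)"
      proof (intro mult_mono)
        have "1 * r \<le> r * r" using r by (intro mult_right_mono) auto
        then show "1 / r\<^sup>2 \<le> 1 / r"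
          using r by (intro divide_left_mono) (auto simp: power2_eq_square)
      qed (use C r in auto)
      finally show ?thesis using w by simp
    next
      case False
      have "(x \<bullet> u)\<^sup>2 * k\<^sup>2 + (x \<bullet> v)\<^sup>2 = r\<^sup>2 * k\<^sup>2"
        using frame_decomposition[OF t0, of x] by (simp add: u_def v_def k_def r_def)
      moreover have "(x \<bullet> u)\<^sup>2 \<le> (r / 2)\<^sup>2"
        using power_mono[of "\<bar>x \<bullet> u\<bar>" "r / 2" 2] False by simp
      then have "(x \<bullet> u)\<^sup>2 * k\<^sup>2 \<le> (r / 2)\<^sup>2 * k\<^sup>2" by (intro mult_right_mono) auto
      ultimately have "3 / 4 * (r\<^sup>2 * k\<^sup>2) \<le> (x \<bullet> v)\<^sup>2" by (simp add: power_divide)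
      moreover have "0 \<le> r\<^sup>2 * k\<^sup>2" by simp
      moreover have "(r * k / 2)\<^sup>2 = r\<^sup>2 * k\<^sup>2 / 4" by (simp add: power_divide power_mult_distrib)
      ultimately have "(r * k / 2)\<^sup>2 \<le> (x \<bullet> v)\<^sup>2" by linarith
      then have "(r * k / 2)\<^sup>2 \<le> \<bar>x \<bullet> v\<bar>\<^sup>2" by (simp only: power2_abs)
      then have big: "r * k / 2 \<le> \<bar>x \<bullet> v\<bar>" by (rule power2_le_imp_le) simp
      define m where "m = pi * r * k / 2"
      have m: "0 < m" using r k by (simp add: m_def)
      \<comment> \<open>Stated for any \<open>y\<close>, to be used with \<open>x\<close> or \<open>- x\<close> according to the sign of \<open>x \<bullet> v\<close>.\<close>
      have conv: "cmod (arc_transform \<gamma> a b y) \<le> 6 / sqrt m"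
        if y: "\<And>t. t \<in> {a..b} \<Longrightarrow> r * (k / 4) \<le> - (y \<bullet> \<gamma>'' t)" for y
        unfolding arc_transform_def
      proof (rule van_der_Corput[where \<phi>'="\<lambda>t. - (2 * pi) * (y \<bullet> \<gamma>' t)" and \<phi>''="\<lambda>t. - (2 * pi) * (y \<bullet> \<gamma>'' t)"])
        fix t assume t: "t \<in> {a..b}"
        show "((\<lambda>t. - (2 * pi) * (y \<bullet> \<gamma> t)) has_real_derivative - (2 * pi) * (y \<bullet> \<gamma>' t)) (at t)"
          "((\<lambda>t. - (2 * pi) * (y \<bullet> \<gamma>' t)) has_real_derivative - (2 * pi) * (y \<bullet> \<gamma>'' t)) (at t)"
          by (intro deriv_inner inL t)+
        show "m \<le> - (2 * pi) * (y \<bullet> \<gamma>'' t)"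
          using mult_left_mono[OF y[OF t], of "2 * pi"] by (simp add: m_def mult_ac)
      qed (use ab m in auto)
      have "cmod (arc_transform \<gamma> a b x) \<le> 6 / sqrt m"
      proof (cases "x \<bullet> v \<le> 0")
        case True
        show ?thesis
        proof (rule conv)
          fix t assume "t \<in> {a..b}"
          then show "r * (k / 4) \<le> - (x \<bullet> \<gamma>'' t)"
            using close2[of t] big True unfolding abs_le_iff by linarith
        qed
      next
        case False
        have "cmod (arc_transform \<gamma> a b (- x)) \<le> 6 / sqrt m"
        proof (rule conv)
          fix t assume "t \<in> {a..b}"
          then show "r * (k / 4) \<le> - ((- x) \<bullet> \<gamma>'' t)"
            using close2[of t] big False unfolding abs_le_iff inner_minus_left by linarith
        qed
        then show ?thesis using arc_transform_uminus[OF ab(1,3)] by simp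
      qed
      then have "(cmod (arc_transform \<gamma> a b x))\<^sup>2 \<le> (6 / sqrt m)\<^sup>2" by (intro power_mono) auto
      also have "\<dots> = 72 / (pi * k) * (1 / r)" using m by (simp add: power_divide m_def)
      also have "\<dots> \<le> C * (1 / r)" using C r by (intro mult_right_mono) auto
      finally show ?thesis using w by simp
    qed
  qed
  then show ?thesis using that[of a b C] ab C by blast
qed

lemma summable_on_region:
  assumes ab: "0 < a" "a < b" "b < L" and c: "0 < c"
    and low: "\<And>x. x \<in> S \<Longrightarrow> c * decay_weight x \<le> (cmod (arc_transform \<gamma> a b x))\<^sup>2"
    and sum: "(\<lambda>l. (cmod (arc_transform \<gamma> a b l))\<^sup>2) summable_on \<Lambda>"
  shows "decay_weight summable_on (\<Lambda> \<inter> S)"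
proof -
  have "(\<lambda>l. 1 / c * (cmod (arc_transform \<gamma> a b l))\<^sup>2) summable_on (\<Lambda> \<inter> S)"
    by (intro summable_on_cmult_right summable_on_subset[OF sum]) auto
  then show ?thesis
  proof (rule summable_on_comparison_test)
    fix x assume "x \<in> \<Lambda> \<inter> S"
    then show "decay_weight x \<le> 1 / c * (cmod (arc_transform \<gamma> a b x))\<^sup>2"
      using low[of x] c by (simp add: field_simps)
  qed (rule less_imp_le[OF decay_weight_pos])
qed

text \<open>
  Each cone around a direction, and each ball, has its own arc whose transform dominates the weight
  there. Compactness of the unit circle leaves finitely many cones.
\<close>

lemma decay_weight_summable:
  assumes sum: "\<And>a b. 0 < a \<Longrightarrow> a < b \<Longrightarrow> b < L \<Longrightarrow>
      (\<lambda>l. (cmod (arc_transform \<gamma> a b l))\<^sup>2) summable_on \<Lambda>"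
  shows "decay_weight summable_on \<Lambda>"
proof -
  have ball: "decay_weight summable_on (\<Lambda> \<inter> {x. norm x \<le> R})" for R
  proof -
    obtain a b c where "0 < a" "a < b" "b < L" "0 < c"
      "\<And>x. norm x \<le> R \<Longrightarrow> c * decay_weight x \<le> (cmod (arc_transform \<gamma> a b x))\<^sup>2"
      using arc_transform_ge_near_origin[of R] by blast
    then show ?thesis by (intro summable_on_region[of a b c] sum) auto
  qed
  define cone :: "real^2 \<Rightarrow> real \<Rightarrow> (real^2) set"
    where "cone e \<delta> = {x. norm (x /\<^sub>R norm x - e) < \<delta>}" for e \<delta>
  have "\<exists>\<delta>>0. decay_weight summable_on (\<Lambda> \<inter> cone e \<delta>)" if e: "norm e = 1" for e
  proof -
    obtain a b c \<delta> R where *: "0 < a" "a < b" "b < L" "0 < c" "0 < \<delta>" "0 < R"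
      "\<And>x. R \<le> norm x \<Longrightarrow> norm (x /\<^sub>R norm x - e) < \<delta> \<Longrightarrow>
         c * decay_weight x \<le> (cmod (arc_transform \<gamma> a b x))\<^sup>2"
      using arc_transform_ge_near_direction[OF e] by blast
    have "decay_weight summable_on (\<Lambda> \<inter> (cone e \<delta> \<inter> {x. R \<le> norm x}))"
      by (rule summable_on_region[OF *(1-4) _ sum[OF *(1-3)]]) (use *(7) in \<open>auto simp: cone_def\<close>)
    from summable_on_union[OF this ball[of R]]
    have "decay_weight summable_on (\<Lambda> \<inter> cone e \<delta>)" by (rule summable_on_subset) auto
    then show ?thesis using *(5) by blast
  qed
  then obtain \<delta> where \<delta>: "\<And>e. norm e = 1 \<Longrightarrow> 0 < \<delta> e"
    and cone: "\<And>e. norm e = 1 \<Longrightarrow> decay_weight summable_on (\<Lambda> \<inter> cone e (\<delta> e))"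
    by metis
  have "compact (sphere (0::real^2) 1)" by simp
  then obtain D where D: "D \<subseteq> sphere 0 1" "finite D" "sphere 0 1 \<subseteq> (\<Union>e\<in>D. ball e (\<delta> e))"
  proof (rule compactE_image)
    show "sphere 0 1 \<subseteq> (\<Union>e\<in>sphere 0 1. ball e (\<delta> e))" using \<delta> by auto
  qed auto
  have "decay_weight summable_on (\<Union>e\<in>D. \<Lambda> \<inter> cone e (\<delta> e))"
    using D(2,1)
  proof (induction D rule: finite_induct)
    case (insert e D)
    then have "decay_weight summable_on ((\<Lambda> \<inter> cone e (\<delta> e)) \<union> (\<Union>e\<in>D. \<Lambda> \<inter> cone e (\<delta> e)))"
      by (intro summable_on_union cone) auto
    then show ?case by simp
  qed simp
  from summable_on_union[OF this ball[of 0]] show ?thesis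
  proof (rule summable_on_subset)
    show "\<Lambda> \<subseteq> (\<Union>e\<in>D. \<Lambda> \<inter> cone e (\<delta> e)) \<union> (\<Lambda> \<inter> {x. norm x \<le> 0})"
    proof
      fix x assume x: "x \<in> \<Lambda>"
      show "x \<in> (\<Union>e\<in>D. \<Lambda> \<inter> cone e (\<delta> e)) \<union> (\<Lambda> \<inter> {x. norm x \<le> 0})"
      proof (cases "x = 0")
        case False
        then have "x /\<^sub>R norm x \<in> sphere 0 1" by simp
        then obtain e where "e \<in> D" "x /\<^sub>R norm x \<in> ball e (\<delta> e)" using D(3) by blast
        then show ?thesis using x by (auto simp: cone_def dist_norm norm_minus_commute)
      qed (use x in simp)
    qed
  qed
qed

text \<open>
  The upper bound on one arc turns the frame identity into a lower bound for all translates of the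
  weight sum, which its summability rules out.
\<close>

lemma no_translation_invariant_arc_sums:
  assumes A: "0 < A"
    and frame: "\<And>a b \<xi>. 0 < a \<Longrightarrow> a < b \<Longrightarrow> b < L \<Longrightarrow>
      ((\<lambda>l. (cmod (arc_transform \<gamma> a b (l - \<xi>)))\<^sup>2) has_sum (A * (b - a))) \<Lambda>"
  shows False
proof -
  obtain a b C where ab: "0 < a" "a < b" "b < L" and C: "0 < C"
    and upper: "\<And>x. (cmod (arc_transform \<gamma> a b x))\<^sup>2 \<le> C * decay_weight x"
    using arc_transform_upper by blast
  have sum: "decay_weight summable_on \<Lambda>"
    using frame[of _ _ 0] by (intro decay_weight_summable) (auto simp: summable_on_def)
  have "0 < A * (b - a) / C" using A ab C by simp
  then obtain \<xi> where \<xi>: "(\<Sum>\<^sub>\<infinity>l\<in>\<Lambda>. decay_weight (l - \<xi>)) < A * (b - a) / C"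
    using translated_decay_weight_sums_not_bounded_below[OF sum] by blast
  have "(\<lambda>l. decay_weight (l - \<xi>)) summable_on \<Lambda>" by (rule decay_weight_translate_summable[OF sum])
  then have "((\<lambda>l. C * decay_weight (l - \<xi>)) has_sum C * (\<Sum>\<^sub>\<infinity>l\<in>\<Lambda>. decay_weight (l - \<xi>))) \<Lambda>"
    by (intro has_sum_cmult_right has_sum_infsum)
  from has_sum_mono[OF frame[OF ab] this upper]
  have "A * (b - a) \<le> C * (\<Sum>\<^sub>\<infinity>l\<in>\<Lambda>. decay_weight (l - \<xi>))" .
  also have "\<dots> < C * (A * (b - a) / C)" using \<xi> C by (intro mult_strict_left_mono) auto
  also have "\<dots> = A * (b - a)" using C by simp
  finally show False by simp
qed

end

section \<open>Smooth closed curves of positive curvature\<close>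

lemma curved_loop_iter_deriv:
  assumes smooth: "smooth_closed_curve L \<gamma>" and unit: "arc_length_parametrized L \<gamma>"
    and curv: "positive_curvature L \<gamma>"
  shows "curved_loop \<gamma> (iter_deriv L 1 \<gamma>) (iter_deriv L 2 \<gamma>) L"
proof
  have diff: "iter_deriv L n \<gamma> differentiable (at t within {0..L})" if "t \<in> {0..L}" for n t
    using smooth that unfolding smooth_closed_curve_def by blast
  have step: "(iter_deriv L n \<gamma> has_vector_derivative iter_deriv L (Suc n) \<gamma> t) (at t)"
    if t: "t \<in> {0<..<L}" for n t
  proof -
    have "(iter_deriv L n \<gamma> has_vector_derivative iter_deriv L (Suc n) \<gamma> t) (at t within {0..L})"
      using diff[of t n] t by (simp add: vector_derivative_works)
    then show ?thesis using t by (simp add: at_within_Icc_at)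
  qed
  show "0 < L" using smooth by (simp add: smooth_closed_curve_def)
  show "continuous_on {0..L} \<gamma>" by (rule smooth_closed_curve_continuous_on[OF smooth])
  show "\<gamma> 0 = \<gamma> L"
    using smooth unfolding smooth_closed_curve_def by (metis iter_deriv.simps(1))
  show "(\<gamma> has_vector_derivative iter_deriv L 1 \<gamma> t) (at t)" if "t \<in> {0<..<L}" for t
    using step[OF that, of 0] by simp
  show "(iter_deriv L 1 \<gamma> has_vector_derivative iter_deriv L 2 \<gamma> t) (at t)" if "t \<in> {0<..<L}" for t
    using step[OF that, of 1] by (simp add: numeral_2_eq_2)
  show "continuous_on {0<..<L} (iter_deriv L 2 \<gamma>)"
  proof (intro continuous_at_imp_continuous_on ballI)
    show "isCont (iter_deriv L 2 \<gamma>) t" if "t \<in> {0<..<L}" for t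
      using has_vector_derivative_continuous[OF step[OF that]] .
  qed
  show "norm (iter_deriv L 1 \<gamma> t) = 1" if "t \<in> {0<..<L}" for t
    using unit that unfolding arc_length_parametrized_def by auto
  show "iter_deriv L 2 \<gamma> t \<noteq> 0" if "t \<in> {0<..<L}" for t
  proof -
    have "curvature L \<gamma> t \<noteq> 0" using curv that unfolding positive_curvature_def by auto
    then show ?thesis unfolding curvature_def by (auto split: if_splits)
  qed
qed

theorem theorem2:
  fixes \<gamma> :: "real \<Rightarrow> real^2" and L :: real
  assumes "smooth_closed_curve L \<gamma>"
    and "arc_length_parametrized L \<gamma>"
    and "positive_curvature L \<gamma>"
    and "finite (self_intersection_points L \<gamma>)"
    and "\<forall>x\<in>self_intersection_points L \<gamma>. transverse_at L \<gamma> x"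
  shows "\<not> tight_frame_spectral (arc_length_measure L \<gamma>)"
proof
  interpret curved_loop \<gamma> "iter_deriv L 1 \<gamma>" "iter_deriv L 2 \<gamma>" L
    by (rule curved_loop_iter_deriv[OF assms(1-3)])
  assume frame: "tight_frame_spectral (arc_length_measure L \<gamma>)"
  show False
  proof (rule tight_frame_arc_transform[OF assms(1,4,5) frame])
    fix \<Lambda> A
    assume "0 < A"
      and "\<And>a b \<xi>. 0 < a \<Longrightarrow> a < b \<Longrightarrow> b < L \<Longrightarrow>
        ((\<lambda>l. (cmod (arc_transform \<gamma> a b (l - \<xi>)))\<^sup>2) has_sum (A * (b - a))) \<Lambda>"
    then show False by (rule no_translation_invariant_arc_sums)
  qed
qed

end
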